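(* Consider the two-dimensional setting described in the context ($\Omega \subset \mathbb{R}^2$, coefficients $\mu_t, \mu_s, p$, sets $\Omega_0$, $\Gamma_\pm$, $D$, $\overline{D}$, and line segments $L_1, \dots, L_K$ with $K \ge 1$ and directions $\xi^{(j)}_\pm$). Let $\gamma$ be two points in $\partial\Omega$, splitting $\partial\Omega$ into two connected components $A$ and $B$, so that $\partial\Omega = A \cup B \cup \gamma$ and $A\cap B = A \cap\gamma = B\cap\gamma = \varnothing$. Let $C$ be a non-zero constant and let $$I_0(x,\xi) = \begin{cases} C, & (x,\xi) \in ((A\cup\gamma)\times S^1)\cap\Gamma_-,\\ 0, & (x,\xi) \in (B\times S^1)\cap\Gamma_-.\end{cases}$$ Let $\overline{I}$ be the extended solution to the boundary value problem with incoming boundary data $I_0$, and let $(x^*,\xi^* ) \in \operatorname{disc}(\overline{I})$. Suppose that $\xi^* \ne \xi^{(j)}_+$ and $\xi^* \neq \xi^{(j)}_-$ for all $j = 1, \dots, K$. Then $$[\overline{I}](x^*,\xi^* ) = C\exp\left(-\int_0^{\tau_-(x^*,\xi^* )} \mu_t(x^* - r\xi^* )\,dr\right),$$ where, for $(\overline{x},\overline{\xi}) \in \operatorname{disc}(\overline{I})$, the jump $[\overline{I}]$ is defined by $$[\overline{I}](\overline{x},\overline{\xi}) := \lim_{\substack{x\to\overline{x}\\ P(x,\overline{\xi})\in A\cup\gamma}} I(x,\overline{\xi}) - \lim_{\substack{x\to\overline{x}\\ P(x,\overline{\xi})\in B}} I(x,\overline{\xi}).$$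
   Context: Domain. $\Omega \subset \mathbb{R}^2$ is a bounded convex domain with $C^1$ boundary, and $n(x)$ is the outer unit normal at $x \in \partial\Omega$. $S^1$ is the unit circle with Lebesgue measure $d\sigma$. Suppose $\overline{\Omega} = \bigcup_{j=1}^N \overline{\Omega_j}$, where $\Omega_1, \dots, \Omega_N$ are disjoint subdomains of $\Omega$ with piecewise $C^1$ boundaries, and put $\Omega_0 := \bigcup_{j=1}^N \Omega_j$. Line segments in the interfaces. It is assumed that $\partial\Omega_0 \setminus \partial\Omega$ contains at most a finite number of (open) line segments, denoted $L_1, \dots, L_K$, and only the case $K \ge 1$ is considered. (This assumption replaces the generalized convexity condition, i.e. the requirement that half lines $\{x - t\xi \mid t \ge 0\}$ meet $\partial\Omega_0$ in a uniformly bounded finite number of points, which is not assumed.) For $1 \le j \le K$, $\xi^{(j)}_+ \in S^1$ is a direction of $L_j$ (for any $x \in L_j$ there is $t>0$ with $x + t\xi^{(j)}_+ \in L_j$), and $\xi^{(j)}_- := -\xi^{(j)}_+$. Coefficients. $\mu_t$ and $\mu_s$ are nonnegative bounded functions with $\mu_t \ge \mu_s$ on $\Omega$, all of whose discontinuity points in $\Omega$ are contained in $\partial\Omega_0$ (so they are continuous on $\Omega_0$), and they are reset to $0$ on $\mathbb{R}^2 \setminus \Omega_0$. $p$ is a nonnegative bounded function on $\mathbb{R}^2 \times S^1 \times S^1$, continuous on $\Omega_0 \times S^1 \times S^1$, equal to $0$ on $(\mathbb{R}^2 \setminus \Omega_0) \times S^1 \times S^1$, and satisfying $\int_{S^1}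 p(x,\xi,\xi')\,d\sigma_{\xi'} = 1$ for all $(x,\xi) \in \Omega_0 \times S^1$. Notation. $\Gamma_\pm := \{(x,\xi) \in \partial\Omega \times S^1 \mid \pm n(x)\cdot\xi > 0\}$; $D := (\Omega \times S^1) \cup \Gamma_-$ and $\overline{D} := D \cup \Gamma_+$. For $(x,\xi) \in \overline{D}$, $\tau_\pm(x,\xi) := \inf\{t>0 \mid x \pm t\xi \notin \Omega\}$ and $P(x,\xi) := x - \tau_-(x,\xi)\xi$. For a function $f$, $\operatorname{disc}(f)$ denotes the set of all discontinuous points of $f$. Boundary value problem. The problem is the stationary transport equation $$\xi\cdot\nabla_x I(x,\xi) + \mu_t(x) I(x,\xi) = \mu_s(x)\int_{S^1} p(x,\xi,\xi') I(x,\xi')\,d\sigma_{\xi'}$$ in $\Omega\times S^1$ with $I = I_0$ on $\Gamma_-$. A solution is by definition a bounded measurable function $I$ on $D$ such that for all $(x,\xi) \in D$ $$I(x,\xi) = e^{-M_t(x,\xi;\tau_-(x,\xi))} I_0(P(x,\xi),\xi) + \int_0^{\tau_-(x,\xi)} \mu_s(x-s\xi)\, e^{-M_t(x,\xi;s)} \int_{S^1} p(x-s\xi,\xi,\xi') I(x-s\xi,\xi')\,d\sigma_{\xi'}\,ds,$$ where $M_t(x,\xi;s) := \int_0^s \mu_t(x-r\xi)\,dr$. For the boundary data $I_0$ considered here, such a solution $I$ exists and is unique. The extended solution $\overline{I}$ on $\overline{D}$ is defined by $\overline{I} := I$ on $D$ and $\overline{I}(x,\xi) := \lim_{t\downarrow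 0} I(x-t\xi,\xi)$ for $(x,\xi)\in\Gamma_+$.
   Formalization: The formal theorem additionally assumes that, apart from the segments L_1,…,L_K, the interface ∂Ω_0 \ ∂Ω meets every straight line in a set of length zero; without this a C^1 interface touching a line in a fat Cantor set gives a discontinuity at which the jump is undefined. *)

theory Defs
  imports "HOL-Analysis.Analysis"
begin

abbreviation S1 :: "(real^2) set" where
  "S1 \<equiv> sphere 0 1"

text \<open>Arc length on the unit circle, as the image of Lebesgue measure under the angle
  parametrisation. Its space is the circle itself, so that measurability and integrals do not
  depend on values of functions off the circle.\<close>

definition circle_measure :: "(real^2) measure" where
  "circle_measure =
     distr (restrict_space lborel {0..<2*pi}) (restrict_space borel S1) (\<lambda>t. vector [cos t, sin t])"

definition perp :: "real^2 \<Rightarrow> real^2" where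
  "perp v = vector [- (v $ 2), v $ 1]"

text \<open>Near \<open>x\<close>, and in the orthonormal coordinates with origin \<open>x\<close> and axes \<open>perp \<nu>\<close> and \<open>\<nu>\<close>,
  the set \<open>U\<close> is the region below the graph of the continuously differentiable \<open>\<phi>\<close>.\<close>

definition C1_chart :: "(real^2) set \<Rightarrow> real^2 \<Rightarrow> real^2 \<Rightarrow> (real \<Rightarrow> real) \<Rightarrow> bool" where
  "C1_chart U x \<nu> \<phi> \<longleftrightarrow>
     norm \<nu> = 1 \<and> \<phi> C1_differentiable_on UNIV \<and>
     (\<exists>r>0. U \<inter> ball x r = {y \<in> ball x r. (y - x) \<bullet> \<nu> < \<phi> ((y - x) \<bullet> perp \<nu>)})"

definition C1_boundary :: "(real^2) set \<Rightarrow> bool" where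
  "C1_boundary U \<longleftrightarrow> (\<forall>x \<in> frontier U. \<exists>\<nu> \<phi>. C1_chart U x \<nu> \<phi>)"

text \<open>The vector normalised here is the gradient at \<open>y = x\<close> of the local defining function
  \<open>(y - x) \<bullet> \<nu> - \<phi> ((y - x) \<bullet> perp \<nu>)\<close>, which is negative exactly inside \<open>U\<close>.\<close>

definition outer_normal :: "(real^2) set \<Rightarrow> real^2 \<Rightarrow> real^2" where
  "outer_normal U x =
     (THE n. \<exists>\<nu> \<phi>. C1_chart U x \<nu> \<phi> \<and> n = sgn (\<nu> - deriv \<phi> 0 *\<^sub>R perp \<nu>))"

text \<open>Finitely many regular \<open>C\<^sup>1\<close> arcs which meet only at end points. The boundary need not be
  connected, and corners, cusps and slits are allowed.\<close>

definition piecewise_C1_boundary :: "(real^2) set \<Rightarrow> bool" where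
  "piecewise_C1_boundary U \<longleftrightarrow>
     (\<exists>(m::nat) (g :: nat \<Rightarrow> real \<Rightarrow> real^2).
        frontier U = (\<Union>i<m. path_image (g i)) \<and>
        (\<forall>i<m. arc (g i) \<and> g i C1_differentiable_on {0..1} \<and>
               (\<forall>t\<in>{0..1}. vector_derivative (g i) (at t) \<noteq> 0)) \<and>
        (\<forall>i<m. \<forall>j<m. i \<noteq> j \<longrightarrow>
           path_image (g i) \<inter> path_image (g j) \<subseteq>
             {pathstart (g i), pathfinish (g i)} \<inter> {pathstart (g j), pathfinish (g j)}))"

text \<open>The open line segments contained in \<open>E\<close> that are not part of a longer one. (Counting
  all segments, a set would contain either none or infinitely many.)\<close>

definition maximal_segments :: "(real^2) set \<Rightarrow> (real^2) set set" where
  "maximal_segments E =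
     {S. (\<exists>a b. a \<noteq> b \<and> S = open_segment a b) \<and> S \<subseteq> E \<and>
         (\<forall>a b. S \<subseteq> open_segment a b \<and> open_segment a b \<subseteq> E \<longrightarrow> open_segment a b = S)}"

text \<open>Every line meets \<open>E\<close> in a set of length zero. A \<open>C\<^sup>1\<close> arc containing no segment may still
  meet a line in positive length: take the graph of a smooth function whose zero set is a Cantor
  set of positive measure. Coefficients that vanish on such an interface produce discontinuities
  along the line, exactly as a segment does.\<close>

definition null_on_lines :: "(real^2) set \<Rightarrow> bool" where
  "null_on_lines E \<longleftrightarrow> (\<forall>x. \<forall>\<xi>\<in>S1. {t. x + t *\<^sub>R \<xi> \<in> E} \<in> null_sets lborel)"

definition Gamma_minus :: "(real^2) set \<Rightarrow> ((real^2) \<times> (real^2)) set" where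
  "Gamma_minus \<Omega> = {(x, \<xi>). x \<in> frontier \<Omega> \<and> \<xi> \<in> S1 \<and> outer_normal \<Omega> x \<bullet> \<xi> < 0}"

definition Gamma_plus :: "(real^2) set \<Rightarrow> ((real^2) \<times> (real^2)) set" where
  "Gamma_plus \<Omega> = {(x, \<xi>). x \<in> frontier \<Omega> \<and> \<xi> \<in> S1 \<and> outer_normal \<Omega> x \<bullet> \<xi> > 0}"

definition phase_D :: "(real^2) set \<Rightarrow> ((real^2) \<times> (real^2)) set" where
  "phase_D \<Omega> = (\<Omega> \<times> S1) \<union> Gamma_minus \<Omega>"

text \<open>This is not the topological closure of \<open>phase_D \<Omega>\<close>: tangential boundary directions are
  left out.\<close>

definition phase_D_bar :: "(real^2) set \<Rightarrow> ((real^2) \<times> (real^2)) set" where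
  "phase_D_bar \<Omega> = phase_D \<Omega> \<union> Gamma_plus \<Omega>"

definition tau_minus :: "(real^2) set \<Rightarrow> real^2 \<Rightarrow> real^2 \<Rightarrow> real" where
  "tau_minus \<Omega> x \<xi> = Inf {t. t > 0 \<and> x - t *\<^sub>R \<xi> \<notin> \<Omega>}"

definition P_in :: "(real^2) set \<Rightarrow> real^2 \<Rightarrow> real^2 \<Rightarrow> real^2" where
  "P_in \<Omega> x \<xi> = x - tau_minus \<Omega> x \<xi> *\<^sub>R \<xi>"

definition M_t :: "(real^2 \<Rightarrow> real) \<Rightarrow> real^2 \<Rightarrow> real^2 \<Rightarrow> real \<Rightarrow> real" where
  "M_t \<mu>t x \<xi> s = (LINT r:{0..s}|lborel. \<mu>t (x - r *\<^sub>R \<xi>))"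

definition transport_solution ::
  "(real^2) set \<Rightarrow> (real^2 \<Rightarrow> real) \<Rightarrow> (real^2 \<Rightarrow> real) \<Rightarrow> (real^2 \<Rightarrow> real^2 \<Rightarrow> real^2 \<Rightarrow> real)
    \<Rightarrow> ((real^2) \<times> (real^2) \<Rightarrow> real) \<Rightarrow> ((real^2) \<times> (real^2) \<Rightarrow> real) \<Rightarrow> bool" where
  "transport_solution \<Omega> \<mu>t \<mu>s p I0 I \<longleftrightarrow>
     bounded (I ` phase_D \<Omega>) \<and>
     I \<in> borel_measurable (restrict_space borel (phase_D \<Omega>)) \<and>
     (\<forall>(x, \<xi>) \<in> phase_D \<Omega>.
        I (x, \<xi>) =
          exp (- M_t \<mu>t x \<xi> (tau_minus \<Omega> x \<xi>)) * I0 (P_in \<Omega> x \<xi>, \<xi>) +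
          (LINT s:{0..tau_minus \<Omega> x \<xi>}|lborel.
             \<mu>s (x - s *\<^sub>R \<xi>) * exp (- M_t \<mu>t x \<xi> s) *
             (LINT \<xi>'|circle_measure. p (x - s *\<^sub>R \<xi>) \<xi> \<xi>' * I (x - s *\<^sub>R \<xi>, \<xi>'))))"

definition extended_solution ::
  "(real^2) set \<Rightarrow> ((real^2) \<times> (real^2) \<Rightarrow> real) \<Rightarrow> ((real^2) \<times> (real^2) \<Rightarrow> real)" where
  "extended_solution \<Omega> I = (\<lambda>(x, \<xi>).
     if (x, \<xi>) \<in> Gamma_plus \<Omega> then Lim (at_right 0) (\<lambda>t. I (x - t *\<^sub>R \<xi>, \<xi>)) else I (x, \<xi>))"

text \<open>Discontinuity points of \<open>f\<close> as a function on the subspace \<open>S\<close>.\<close>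

definition disc_on :: "'a::t2_space set \<Rightarrow> ('a \<Rightarrow> 'b::topological_space) \<Rightarrow> 'a set" where
  "disc_on S f = {z \<in> S. \<not> continuous (at z within S) f}"

text \<open>The approach \<open>x \<rightarrow> x0\<close>, with the direction \<open>\<xi>\<close> fixed, through points of the domain of \<open>I\<close>
  whose backward exit point lies in \<open>T\<close>.\<close>

definition approach ::
  "(real^2) set \<Rightarrow> (real^2) set \<Rightarrow> real^2 \<Rightarrow> real^2 \<Rightarrow> (real^2) filter" where
  "approach \<Omega> T x0 \<xi> = at x0 within {x. (x, \<xi>) \<in> phase_D \<Omega> \<and> P_in \<Omega> x \<xi> \<in> T}"

text \<open>The difference of the one-sided limits exists and equals \<open>J\<close>. The filters are required to be
  proper, so that the limits are unique.\<close>

definition has_jump ::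
  "(real^2) set \<Rightarrow> (real^2) set \<Rightarrow> (real^2) set \<Rightarrow> ((real^2) \<times> (real^2) \<Rightarrow> real)
    \<Rightarrow> real^2 \<Rightarrow> real^2 \<Rightarrow> real \<Rightarrow> bool" where
  "has_jump \<Omega> T1 T2 I x0 \<xi> J \<longleftrightarrow>
     approach \<Omega> T1 x0 \<xi> \<noteq> bot \<and> approach \<Omega> T2 x0 \<xi> \<noteq> bot \<and>
     (\<exists>l1 l2. ((\<lambda>x. I (x, \<xi>)) \<longlongrightarrow> l1) (approach \<Omega> T1 x0 \<xi>) \<and>
              ((\<lambda>x. I (x, \<xi>)) \<longlongrightarrow> l2) (approach \<Omega> T2 x0 \<xi>) \<and>
              J = l1 - l2)"

end

theory Submission
  imports Defs
begin

text \<open>On the phase space without the finitely many directions of straight interfaces the solution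
  splits as \<open>I = exp (- M) I0(P) + F\<close> with \<open>F\<close> the integral of the scattered radiation along the
  backward ray. Almost every point of such a ray is a continuity point of the coefficients, so by
  dominated convergence \<open>M\<close> is continuous, and \<open>F\<close> is too once the scattering integral of \<open>I\<close> is
  continuous on \<open>\<Omega>0 \<times> S1\<close>. The iteration \<open>f \<mapsto> exp (- M) I0(P) + F f\<close> started at \<open>0\<close> consists of
  functions which at each point are continuous in all but finitely many directions, hence have
  continuous scattering integrals, and it converges uniformly to \<open>I\<close>: because \<open>\<mu>s \<le> \<mu>t\<close> and \<open>p\<close> has
  total mass \<open>1\<close>, it contracts with factor \<open>1 - exp (- m R)\<close>, where \<open>m\<close> bounds \<open>\<mu>t\<close> and \<open>R\<close> the length of
  the rays. Thus \<open>F\<close> is continuous and every jump comes from \<open>I0(P)\<close>, which is locally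
  constant unless \<open>P\<close> is one of the two points of \<open>\<gamma>\<close>; both arcs accumulate at each of them.\<close>

subsection \<open>Geometry of the domain\<close>

text \<open>The obstacle is a circle: continuity of \<open>I\<close> rests on continuity of its
  scattering integral, while \<open>I\<close> is known only to be bounded and measurable. The
  iterates break it, since they are regular by construction and are compared with \<open>I\<close>
  through its own equation. The factor \<open>1 - exp (- (m * R))\<close> is the integral of
  \<open>\<mu>t\<close> times \<open>exp (- M_t)\<close>, a derivative up to sign, so it stays below
  1 even for \<open>\<mu>s = \<mu>t\<close>: all that counts is that rays in a bounded domain have
  bounded length. Interface directions are dangerous because a ray may run inside an interface for a
  positive length, where the coefficients have no continuity. Being finitely many they are null on
  the circle, so they never disturb a scattering integral. Continuity must hold up to the outflow
  boundary, where the extended solution is defined by limits. This works because tangential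
  directions are left out: every line that occurs crosses \<Omega>, and exit times vary
  continuously. In the jump the direction is fixed, so the scattered part and the attenuation have
  the same limits on both sides; only the boundary value differs.\<close>

lemma perp_simps:
  "perp v \<bullet> v = 0" "v \<bullet> perp v = 0" "norm (perp v) = norm v"
  by (auto simp: perp_def inner_vec_def sum_2 norm_vec_def L2_set_def add.commute)

lemma C1_chart_deriv:
  assumes "C1_chart U x \<nu> \<phi>"
  shows "(\<phi> has_real_derivative deriv \<phi> t) (at t)"
  using assms unfolding C1_chart_def C1_differentiable_on_eq
  by (metis DERIV_deriv_iff_real_differentiable UNIV_I)

text \<open>Squeezed from both sides: a positive value would put \<open>x\<close> into the open set
  \<open>U\<close>, a negative one would keep a whole neighbourhood of \<open>x\<close> out of
  \<open>U\<close>.\<close>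

lemma C1_chart_zero:
  assumes U: "open U" "x \<in> frontier U" and ch: "C1_chart U x \<nu> \<phi>"
  shows "\<phi> 0 = 0"
proof (rule ccontr)
  assume nz: "\<phi> 0 \<noteq> 0"
  obtain r where r: "r > 0" "U \<inter> ball x r = {y \<in> ball x r. (y - x) \<bullet> \<nu> < \<phi> ((y - x) \<bullet> perp \<nu>)}"
    using ch unfolding C1_chart_def by auto
  have xU: "x \<notin> U" "x \<in> closure U"
    using U by (auto simp: frontier_def interior_open)
  have "\<not> 0 < \<phi> 0"
    using r xU by (auto simp: set_eq_iff dest!: spec[of _ x])
  with nz have neg: "\<phi> 0 < 0" by simp
  have "isCont \<phi> ((x - x) \<bullet> perp \<nu>)"
    using C1_chart_deriv[OF ch] DERIV_isCont by blast
  hence "isCont (\<lambda>y. \<phi> ((y - x) \<bullet> perp \<nu>)) x"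
    by (intro isCont_o2[where g = \<phi> and f = "\<lambda>y. (y - x) \<bullet> perp \<nu>"] continuous_intros)
  hence "isCont (\<lambda>y. (y - x) \<bullet> \<nu> - \<phi> ((y - x) \<bullet> perp \<nu>)) x"
    by (intro continuous_diff continuous_intros)
  hence "\<forall>\<^sub>F y in at x. (y - x) \<bullet> \<nu> - \<phi> ((y - x) \<bullet> perp \<nu>) > 0"
    using neg by (intro order_tendstoD) (auto simp: isCont_def)
  then obtain d where d: "d > 0" "\<And>y. y \<noteq> x \<Longrightarrow> dist y x < d \<Longrightarrow> (y - x) \<bullet> \<nu> - \<phi> ((y - x) \<bullet> perp \<nu>) > 0"
    unfolding eventually_at by auto
  obtain y where y: "y \<in> U" "dist y x < min d r"
    using xU(2) d(1) r(1) unfolding closure_approachable by (metis min_less_iff_conj)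
  hence "y \<in> U \<inter> ball x r" "y \<noteq> x" using xU by (auto simp: dist_commute)
  hence "(y - x) \<bullet> \<nu> < \<phi> ((y - x) \<bullet> perp \<nu>)" using r(2) by blast
  with d(2)[of y] \<open>y \<noteq> x\<close> y show False by simp
qed

text \<open>Along the ray the local defining function is \<open>h\<close>; it vanishes at 0 with
  slope \<open>v \<bullet> w\<close>, and the sign of the slope decides the side. Its gradient
  \<open>w\<close> is nonzero because \<open>w \<bullet> \<nu> = 1\<close>.\<close>

lemma C1_chart_rays:
  assumes U: "open U" "x \<in> frontier U" and ch: "C1_chart U x \<nu> \<phi>"
    and n: "n = sgn (\<nu> - deriv \<phi> 0 *\<^sub>R perp \<nu>)"
  shows "norm n = 1"
    and "n \<bullet> v < 0 \<Longrightarrow> \<exists>d>0. \<forall>t. 0 < t \<and> t < d \<longrightarrow> x + t *\<^sub>R v \<in> U"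
    and "n \<bullet> v > 0 \<Longrightarrow> \<exists>d>0. \<forall>t. 0 < t \<and> t < d \<longrightarrow> x + t *\<^sub>R v \<notin> U"
proof -
  define w where "w = \<nu> - deriv \<phi> 0 *\<^sub>R perp \<nu>"
  obtain r where r: "r > 0" "U \<inter> ball x r = {y \<in> ball x r. (y - x) \<bullet> \<nu> < \<phi> ((y - x) \<bullet> perp \<nu>)}"
    using ch unfolding C1_chart_def by auto
  have nu: "norm \<nu> = 1" using ch unfolding C1_chart_def by auto
  have "w \<bullet> \<nu> = 1"
    using nu by (simp add: w_def inner_diff_left perp_simps norm_eq_1)
  hence w0: "w \<noteq> 0" by auto
  show "norm n = 1" using w0 n by (simp add: norm_sgn flip: w_def)
  define h where "h t = t * (v \<bullet> \<nu>) - \<phi> (t * (v \<bullet> perp \<nu>))" for t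
  have h0: "h 0 = 0" using C1_chart_zero[OF U ch] by (simp add: h_def)
  have "(\<phi> has_real_derivative deriv \<phi> 0) (at (0 * (v \<bullet> perp \<nu>)))"
    using C1_chart_deriv[OF ch, of 0] by simp
  hence "((\<lambda>t. \<phi> (t * (v \<bullet> perp \<nu>))) has_real_derivative deriv \<phi> 0 * (v \<bullet> perp \<nu>)) (at 0)"
    by (rule DERIV_chain2) (auto intro!: derivative_eq_intros)
  hence dh: "(h has_real_derivative v \<bullet> w) (at 0)"
    unfolding h_def w_def by (auto intro!: derivative_eq_intros simp: inner_diff_right)
  \<comment> \<open>The \<open>+ 1\<close> admits \<open>v = 0\<close> and still keeps
    \<open>t * norm v\<close> below the chart radius.\<close>
  have memU: "x + t *\<^sub>R v \<in> U \<longleftrightarrow> h t < 0" if "0 < t" "t * (norm v + 1) < r" for t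
  proof -
    have "t * norm v < r" using that by (simp add: algebra_simps)
    hence "x + t *\<^sub>R v \<in> ball x r" using that by (simp add: dist_norm)
    with r(2) have "x + t *\<^sub>R v \<in> U \<longleftrightarrow> (t *\<^sub>R v) \<bullet> \<nu> < \<phi> ((t *\<^sub>R v) \<bullet> perp \<nu>)"
      by (auto simp: set_eq_iff dest!: spec[of _ "x + t *\<^sub>R v"])
    thus ?thesis by (simp add: h_def)
  qed
  have small: "t * (norm v + 1) < r" if "t < r / (norm v + 1)" for t
    using that norm_ge_zero[of v] by (simp add: pos_less_divide_eq add_nonneg_pos)
  have pos: "r / (norm v + 1) > 0" using r(1) norm_ge_zero[of v] by (simp add: add_nonneg_pos)
  have sg: "n \<bullet> v = (v \<bullet> w) / norm w"
    using n by (simp add: sgn_div_norm inner_commute divide_inverse mult.commute flip: w_def)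
  { assume "n \<bullet> v < 0"
    hence "v \<bullet> w < 0" using w0 sg by (simp add: divide_less_0_iff)
    from has_real_derivative_neg_dec_right[OF dh this] obtain d where
      "d > 0" "\<And>t. 0 < t \<Longrightarrow> t < d \<Longrightarrow> h t < 0" using h0 by auto
    thus "\<exists>d>0. \<forall>t. 0 < t \<and> t < d \<longrightarrow> x + t *\<^sub>R v \<in> U"
      using memU small pos by (intro exI[of _ "min d (r / (norm v + 1))"]) auto }
  { assume "n \<bullet> v > 0"
    hence "v \<bullet> w > 0" using w0 sg by (simp add: zero_less_divide_iff)
    from has_real_derivative_pos_inc_right[OF dh this] obtain d where
      "d > 0" "\<And>t. 0 < t \<Longrightarrow> t < d \<Longrightarrow> h t > 0" using h0 by auto
    thus "\<exists>d>0. \<forall>t. 0 < t \<and> t < d \<longrightarrow> x + t *\<^sub>R v \<notin> U"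
      using memU small pos by (intro exI[of _ "min d (r / (norm v + 1))"]) (auto simp: not_less less_imp_le) }
qed

text \<open>Two different unit normals have inner product below 1, so their difference would point
  into \<open>U\<close> for one chart and out of \<open>U\<close> for the other.\<close>

lemma C1_chart_normal_unique:
  assumes U: "open U" "x \<in> frontier U" and ch: "C1_chart U x \<nu> \<phi>" "C1_chart U x \<nu>' \<phi>'"
  shows "sgn (\<nu> - deriv \<phi> 0 *\<^sub>R perp \<nu>) = sgn (\<nu>' - deriv \<phi>' 0 *\<^sub>R perp \<nu>')" (is "?n = ?n'")
proof (rule ccontr)
  assume ne: "?n \<noteq> ?n'"
  note R = C1_chart_rays[OF U ch(1) refl] and R' = C1_chart_rays[OF U ch(2) refl]
  have "0 < (norm (?n' - ?n))\<^sup>2" using ne by simp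
  also have "(norm (?n' - ?n))\<^sup>2 = 2 - 2 * (?n \<bullet> ?n')"
    using R(1) R'(1) unfolding power2_norm_eq_inner
    by (simp add: inner_diff_left inner_diff_right inner_commute norm_eq_1)
  finally have lt: "?n \<bullet> ?n' < 1" by simp
  have "?n \<bullet> (?n' - ?n) < 0" "?n' \<bullet> (?n' - ?n) > 0"
    using lt R(1) R'(1) by (simp_all add: inner_diff_right norm_eq_1 inner_commute)
  from R(2)[OF this(1)] R'(3)[OF this(2)] obtain d e where
    de: "d > 0" "\<forall>t. 0 < t \<and> t < d \<longrightarrow> x + t *\<^sub>R (?n' - ?n) \<in> U"
    "e > 0" "\<forall>t. 0 < t \<and> t < e \<longrightarrow> x + t *\<^sub>R (?n' - ?n) \<notin> U" by blast
  have "0 < min d e / 2 \<and> min d e / 2 < d" "0 < min d e / 2 \<and> min d e / 2 < e"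
    using de by auto
  with de show False by blast
qed

lemma outer_normal_rays:
  assumes U: "open U" "x \<in> frontier U" "C1_boundary U"
  shows "norm (outer_normal U x) = 1"
    and "outer_normal U x \<bullet> v < 0 \<Longrightarrow> \<exists>d>0. \<forall>t. 0 < t \<and> t < d \<longrightarrow> x + t *\<^sub>R v \<in> U"
    and "outer_normal U x \<bullet> v > 0 \<Longrightarrow> \<exists>d>0. \<forall>t. 0 < t \<and> t < d \<longrightarrow> x + t *\<^sub>R v \<notin> U"
proof -
  obtain \<nu> \<phi> where ch: "C1_chart U x \<nu> \<phi>"
    using U unfolding C1_boundary_def by blast
  have "outer_normal U x = sgn (\<nu> - deriv \<phi> 0 *\<^sub>R perp \<nu>)"
    unfolding outer_normal_def
  proof (rule the_equality)
    show "\<exists>\<nu>' \<phi>'. C1_chart U x \<nu>' \<phi>' \<and>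
        sgn (\<nu> - deriv \<phi> 0 *\<^sub>R perp \<nu>) = sgn (\<nu>' - deriv \<phi>' 0 *\<^sub>R perp \<nu>')"
      using ch by blast
    fix n assume "\<exists>\<nu>' \<phi>'. C1_chart U x \<nu>' \<phi>' \<and> n = sgn (\<nu>' - deriv \<phi>' 0 *\<^sub>R perp \<nu>')"
    then obtain \<nu>' \<phi>' where "C1_chart U x \<nu>' \<phi>'" "n = sgn (\<nu>' - deriv \<phi>' 0 *\<^sub>R perp \<nu>')"
      by blast
    thus "n = sgn (\<nu> - deriv \<phi> 0 *\<^sub>R perp \<nu>)"
      using C1_chart_normal_unique[OF U(1,2) _ ch] by simp
  qed
  note R = C1_chart_rays[OF U(1,2) ch this]
  show "norm (outer_normal U x) = 1"
    and "outer_normal U x \<bullet> v < 0 \<Longrightarrow> \<exists>d>0. \<forall>t. 0 < t \<and> t < d \<longrightarrow> x + t *\<^sub>R v \<in> U"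
    and "outer_normal U x \<bullet> v > 0 \<Longrightarrow> \<exists>d>0. \<forall>t. 0 < t \<and> t < d \<longrightarrow> x + t *\<^sub>R v \<notin> U"
    by (fact R)+
qed

section \<open>Rays in a convex domain: exit time and entry point\<close>

lemma convex_open_ray_shrink:
  fixes U :: "'a::euclidean_space set"
  assumes "open U" "convex U" "x \<in> closure U" "x + t *\<^sub>R v \<in> U" "0 < s" "s \<le> t"
  shows "x + s *\<^sub>R v \<in> U"
proof -
  have "x - (s / t) *\<^sub>R (x - (x + t *\<^sub>R v)) \<in> interior U"
    using assms by (intro mem_interior_closure_convex_shrink) (auto simp: interior_open)
  thus ?thesis using assms by (simp add: interior_open)
qed

locale C1_convex_domain =
  fixes \<Omega> :: "(real^2) set"
  assumes open_dom: "open \<Omega>" and convex_dom: "convex \<Omega>" and bounded_dom: "bounded \<Omega>"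
    and C1_dom: "C1_boundary \<Omega>"
begin

lemmas ray_shrink = convex_open_ray_shrink[OF open_dom convex_dom]

text \<open>Replaces the analytic normal by a statement about rays, on which all further geometry
  rests. From right to left the difficulty is strictness: an entering direction can be tilted a
  little outward and still enters, so its normal component is not merely nonpositive.\<close>

lemma outer_normal_neg_iff:
  assumes x: "x \<in> frontier \<Omega>"
  shows "outer_normal \<Omega> x \<bullet> v < 0 \<longleftrightarrow> (\<exists>t>0. x + t *\<^sub>R v \<in> \<Omega>)"
proof
  note R = outer_normal_rays[OF open_dom x C1_dom]
  have xc: "x \<in> closure \<Omega>" using x by (simp add: frontier_def)
  let ?n = "outer_normal \<Omega> x"
  {
    assume "?n \<bullet> v < 0"
    from R(2)[OF this] obtain d where "d > 0" "\<forall>t. 0 < t \<and> t < d \<longrightarrow> x + t *\<^sub>R v \<in> \<Omega>" by blast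
    hence "d / 2 > 0" "x + (d / 2) *\<^sub>R v \<in> \<Omega>" by auto
    thus "\<exists>t>0. x + t *\<^sub>R v \<in> \<Omega>" by blast
  }
  {
    assume "\<exists>t>0. x + t *\<^sub>R v \<in> \<Omega>"
    then obtain t where t: "t > 0" "x + t *\<^sub>R v \<in> \<Omega>" by blast
    then obtain e where e: "e > 0" "ball (x + t *\<^sub>R v) e \<subseteq> \<Omega>"
      using openE[OF open_dom] by blast
    \<comment> \<open>The tilt moves the point at parameter \<open>t\<close> by \<open>e / 2\<close>
      only, inside the ball of radius \<open>e\<close>.\<close>
    define w where "w = v + (e / (2 * t)) *\<^sub>R ?n"
    have "x + t *\<^sub>R w = x + t *\<^sub>R v + (e / 2) *\<^sub>R ?n"
      using t by (simp add: w_def algebra_simps)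
    also have "\<dots> \<in> \<Omega>" using e R(1) by (intro subsetD[OF e(2)]) (simp add: dist_norm)
    finally have tw: "x + t *\<^sub>R w \<in> \<Omega>" .
    have "\<not> ?n \<bullet> w > 0"
    proof
      assume "?n \<bullet> w > 0"
      from R(3)[OF this] obtain d where d: "d > 0" "\<forall>s. 0 < s \<and> s < d \<longrightarrow> x + s *\<^sub>R w \<notin> \<Omega>" by blast
      have "x + (min d t / 2) *\<^sub>R w \<in> \<Omega>" using d t by (intro ray_shrink[OF xc tw]) auto
      moreover have "0 < min d t / 2 \<and> min d t / 2 < d" using d t by auto
      ultimately show False using d by blast
    qed
    moreover have "?n \<bullet> w = ?n \<bullet> v + e / (2 * t)"
      using R(1) by (simp add: w_def inner_add_right norm_eq_1)
    moreover have "e / (2 * t) > 0" using e t by simp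
    ultimately show "?n \<bullet> v < 0" by linarith
  }
qed

lemma Gamma_minus_eq:
  "Gamma_minus \<Omega> = {(x, \<xi>). x \<in> frontier \<Omega> \<and> \<xi> \<in> S1 \<and> (\<exists>t>0. x + t *\<^sub>R \<xi> \<in> \<Omega>)}"
  unfolding Gamma_minus_def using outer_normal_neg_iff by blast

lemma Gamma_plus_eq:
  "Gamma_plus \<Omega> = {(x, \<xi>). x \<in> frontier \<Omega> \<and> \<xi> \<in> S1 \<and> (\<exists>t>0. x - t *\<^sub>R \<xi> \<in> \<Omega>)}"
proof -
  have "outer_normal \<Omega> x \<bullet> \<xi> > 0 \<longleftrightarrow> (\<exists>t>0. x - t *\<^sub>R \<xi> \<in> \<Omega>)" if "x \<in> frontier \<Omega>" for x \<xi>
    using outer_normal_neg_iff[OF that, of "- \<xi>"] by simp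
  thus ?thesis unfolding Gamma_plus_def by blast
qed

text \<open>The last claim is the absence of tangential directions. It prevents a line that merely
  touches the boundary, for which the exit time would be discontinuous.\<close>

lemma phase_D_barD:
  assumes "(x, \<xi>) \<in> phase_D_bar \<Omega>"
  shows "x \<in> closure \<Omega>" "\<xi> \<in> S1" "norm \<xi> = 1"
    "(\<exists>t>0. x - t *\<^sub>R \<xi> \<in> \<Omega>) \<or> (\<exists>t>0. x + t *\<^sub>R \<xi> \<in> \<Omega>)"
proof -
  show "x \<in> closure \<Omega>" "\<xi> \<in> S1" "norm \<xi> = 1"
    using assms closure_subset[of \<Omega>]
    unfolding phase_D_bar_def phase_D_def Gamma_minus_eq Gamma_plus_eq frontier_def
    by auto
  show "(\<exists>t>0. x - t *\<^sub>R \<xi> \<in> \<Omega>) \<or> (\<exists>t>0. x + t *\<^sub>R \<xi> \<in> \<Omega>)"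
  proof (cases "x \<in> \<Omega>")
    case True
    then obtain e where e: "e > 0" "ball x e \<subseteq> \<Omega>" using openE[OF open_dom] by blast
    have "x - (e / 2) *\<^sub>R \<xi> \<in> \<Omega>"
      using e \<open>norm \<xi> = 1\<close> by (intro subsetD[OF e(2)]) (simp add: dist_norm)
    thus ?thesis using e by (intro disjI1 exI[of _ "e / 2"]) simp
  next
    case False
    thus ?thesis using assms
      unfolding phase_D_bar_def phase_D_def Gamma_minus_eq Gamma_plus_eq by auto
  qed
qed

lemma exists_radius: "\<exists>R>0. \<forall>x\<in>closure \<Omega>. \<forall>\<xi>\<in>S1. \<forall>t>R. x - t *\<^sub>R \<xi> \<notin> \<Omega>"
proof -
  obtain R where R: "R > 0" "\<And>x. x \<in> closure \<Omega> \<Longrightarrow> norm x \<le> R"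
    using bounded_closure[OF bounded_dom] bounded_pos by metis
  have "x - t *\<^sub>R \<xi> \<notin> \<Omega>" if "x \<in> closure \<Omega>" "\<xi> \<in> S1" "t > 2 * R" for x \<xi> t
  proof
    assume "x - t *\<^sub>R \<xi> \<in> \<Omega>"
    hence "norm (x - t *\<^sub>R \<xi>) \<le> R" using R closure_subset[of \<Omega>] by blast
    moreover have "norm (t *\<^sub>R \<xi>) \<le> norm x + norm (x - t *\<^sub>R \<xi>)"
      using norm_triangle_ineq4[of x "x - t *\<^sub>R \<xi>"] by simp
    ultimately show False using that R(1) R(2)[OF that(1)] by simp
  qed
  thus ?thesis using R(1) by (intro exI[of _ "2 * R"]) auto
qed

text \<open>By convexity a ray that has left \<Omega> does not return, and beyond the infimum it
  even avoids the closure. That stronger form yields upper semicontinuity of the exit time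
  later.\<close>

lemma tau_minus:
  assumes D: "(x, \<xi>) \<in> phase_D_bar \<Omega>"
  shows tau_minus_nonneg: "0 \<le> tau_minus \<Omega> x \<xi>"
    and before_tau_minus: "0 < t \<Longrightarrow> t < tau_minus \<Omega> x \<xi> \<Longrightarrow> x - t *\<^sub>R \<xi> \<in> \<Omega>"
    and after_tau_minus: "tau_minus \<Omega> x \<xi> < t \<Longrightarrow> x - t *\<^sub>R \<xi> \<notin> closure \<Omega>"
    and P_in_Gamma_minus: "(P_in \<Omega> x \<xi>, \<xi>) \<in> Gamma_minus \<Omega>"
proof -
  note D' = phase_D_barD[OF D]
  define T where "T = {t. t > 0 \<and> x - t *\<^sub>R \<xi> \<notin> \<Omega>}"
  let ?\<tau> = "tau_minus \<Omega> x \<xi>"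
  have tau: "?\<tau> = Inf T" by (simp add: tau_minus_def T_def)
  have ne: "T \<noteq> {}"
  proof -
    obtain R where R: "R > 0" "\<forall>x\<in>closure \<Omega>. \<forall>\<xi>\<in>S1. \<forall>t>R. x - t *\<^sub>R \<xi> \<notin> \<Omega>"
      using exists_radius by blast
    have "x - (R + 1) *\<^sub>R \<xi> \<notin> \<Omega>" using R(2) D'(1,2) by (meson less_add_one)
    hence "R + 1 \<in> T" using R(1) by (simp add: T_def)
    thus ?thesis by blast
  qed
  have bdd: "bdd_below T" by (auto simp: T_def intro!: bdd_belowI[of _ 0])
  show nn: "0 \<le> ?\<tau>" unfolding tau using ne by (intro cInf_greatest) (auto simp: T_def)
  show bef: "x - t *\<^sub>R \<xi> \<in> \<Omega>" if "0 < t" "t < ?\<tau>" for t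
  proof (rule ccontr)
    assume "x - t *\<^sub>R \<xi> \<notin> \<Omega>"
    hence "t \<in> T" using that by (simp add: T_def)
    with cInf_lower[OF this bdd] that show False unfolding tau by simp
  qed
  show aft: "x - t *\<^sub>R \<xi> \<notin> closure \<Omega>" if "?\<tau> < t" for t
  proof
    assume cl: "x - t *\<^sub>R \<xi> \<in> closure \<Omega>"
    have "Inf T < t" using that by (simp only: tau)
    from cInf_lessD[OF ne this] obtain s where s: "s \<in> T" "s < t" by blast
    \<comment> \<open>The segment from the closure point at parameter \<open>t\<close> to a point of
      \<Omega> at \<open>u < s\<close> passes through parameter \<open>s\<close>, so
      \<open>s\<close> could not belong to \<open>T\<close>.\<close>
    have *: "x - s *\<^sub>R \<xi> \<in> \<Omega>" if "x - u *\<^sub>R \<xi> \<in> \<Omega>" "u < s" for u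
    proof -
      have "x - t *\<^sub>R \<xi> + (t - u) *\<^sub>R \<xi> \<in> \<Omega>"
        using that(1) by (simp add: algebra_simps)
      from ray_shrink[OF cl this, of "t - s"] that(2) s(2)
      have "x - t *\<^sub>R \<xi> + (t - s) *\<^sub>R \<xi> \<in> \<Omega>" by simp
      thus ?thesis by (simp add: algebra_simps)
    qed
    from D'(4) show False
    proof
      assume "\<exists>u>0. x - u *\<^sub>R \<xi> \<in> \<Omega>"
      then obtain u where u: "u > 0" "x - u *\<^sub>R \<xi> \<in> \<Omega>" by blast
      have "\<not> s \<le> u"
        using ray_shrink[OF D'(1), of u "- \<xi>" s] u s(1) by (auto simp: T_def)
      hence "u < s" by simp
      with *[OF u(2)] s show False by (simp add: T_def)
    next
      assume "\<exists>u>0. x + u *\<^sub>R \<xi> \<in> \<Omega>"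
      then obtain u where u: "u > 0" "x + u *\<^sub>R \<xi> \<in> \<Omega>" by blast
      with *[of "- u"] s show False by (simp add: T_def)
    qed
  qed
  let ?P = "P_in \<Omega> x \<xi>"
  have P: "?P = x - ?\<tau> *\<^sub>R \<xi>" by (simp add: P_in_def)
  have near: "\<exists>d>0. \<forall>s. \<bar>s - ?\<tau>\<bar> < d \<longrightarrow> x - s *\<^sub>R \<xi> \<in> S" if S: "open S" "?P \<in> S" for S
  proof -
    obtain e where e: "e > 0" "ball ?P e \<subseteq> S" using openE[OF S] by blast
    have "x - s *\<^sub>R \<xi> \<in> S" if "\<bar>s - ?\<tau>\<bar> < e" for s
    proof (intro subsetD[OF e(2)])
      have "?P - (x - s *\<^sub>R \<xi>) = (s - ?\<tau>) *\<^sub>R \<xi>" by (simp add: P algebra_simps)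
      thus "x - s *\<^sub>R \<xi> \<in> ball ?P e" using that D'(3) by (simp add: dist_norm)
    qed
    thus ?thesis using e(1) by blast
  qed
  have "?P \<notin> \<Omega>"
  proof
    assume "?P \<in> \<Omega>"
    from near[OF open_dom this] obtain d where d: "d > 0" "\<forall>s. \<bar>s - ?\<tau>\<bar> < d \<longrightarrow> x - s *\<^sub>R \<xi> \<in> \<Omega>" by blast
    hence "x - (?\<tau> + d / 2) *\<^sub>R \<xi> \<in> \<Omega>" by auto
    moreover have "x - (?\<tau> + d / 2) *\<^sub>R \<xi> \<notin> closure \<Omega>" using d(1) by (intro aft) simp
    ultimately show False using closure_subset[of \<Omega>] by blast
  qed
  moreover have "?P \<in> closure \<Omega>"
  proof (rule ccontr)
    assume n: "?P \<notin> closure \<Omega>"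
    hence t0: "?\<tau> \<noteq> 0" using D'(1) by (auto simp: P)
    from n near[of "- closure \<Omega>"] obtain d where
      d: "d > 0" "\<forall>s. \<bar>s - ?\<tau>\<bar> < d \<longrightarrow> x - s *\<^sub>R \<xi> \<notin> closure \<Omega>" by auto
    define s where "s = ?\<tau> - min d ?\<tau> / 2"
    have "0 < s" "s < ?\<tau>" "\<bar>s - ?\<tau>\<bar> < d" using d nn t0 by (auto simp: s_def)
    with bef[of s] d closure_subset[of \<Omega>] show False by blast
  qed
  moreover have "\<exists>t>0. ?P + t *\<^sub>R \<xi> \<in> \<Omega>"
  \<comment> \<open>With exit time 0 nothing behind \<open>x\<close> lies in \<Omega>, so the line,
    which crosses \<Omega>, does so ahead of \<open>x\<close>.\<close>
  proof (cases "?\<tau> = 0")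
    case True
    hence "x - t *\<^sub>R \<xi> \<notin> \<Omega>" if "t > 0" for t using aft[of t] that closure_subset[of \<Omega>] by auto
    with D'(4) True show ?thesis by (auto simp: P)
  next
    case False
    have "?P + (?\<tau> / 2) *\<^sub>R \<xi> = x - (?\<tau> - ?\<tau> / 2) *\<^sub>R \<xi>"
      unfolding P scaleR_left_diff_distrib by simp
    moreover have "x - (?\<tau> - ?\<tau> / 2) *\<^sub>R \<xi> \<in> \<Omega>" using False nn by (intro bef) auto
    ultimately have "?P + (?\<tau> / 2) *\<^sub>R \<xi> \<in> \<Omega>" by (simp only:)
    thus ?thesis using False nn by (intro exI[of _ "?\<tau> / 2"]) auto
  qed
  ultimately show "(?P, \<xi>) \<in> Gamma_minus \<Omega>"
    using D'(2) open_dom by (auto simp: Gamma_minus_eq frontier_def interior_open)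
qed

lemma P_in_frontier:
  assumes "(x, \<xi>) \<in> phase_D_bar \<Omega>"
  shows "P_in \<Omega> x \<xi> \<in> frontier \<Omega>"
  using P_in_Gamma_minus[OF assms] by (simp add: Gamma_minus_def)

lemma frontier_on_ray:
  assumes D: "(x, \<xi>) \<in> phase_D_bar \<Omega>" and "0 \<le> t" "x - t *\<^sub>R \<xi> \<in> frontier \<Omega>"
  shows "t \<in> {0, tau_minus \<Omega> x \<xi>}"
proof -
  have "x - t *\<^sub>R \<xi> \<notin> \<Omega>" "x - t *\<^sub>R \<xi> \<in> closure \<Omega>"
    using assms(3) open_dom by (auto simp: frontier_def interior_open)
  hence "\<not> (0 < t \<and> t < tau_minus \<Omega> x \<xi>)" "\<not> tau_minus \<Omega> x \<xi> < t"
    using before_tau_minus[OF D] after_tau_minus[OF D] by blast+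
  with assms(2) show ?thesis by auto
qed

text \<open>A later exit would leave a point of \<Omega> behind \<open>y\<close>; with the point of
  \<Omega> ahead of it, convexity would put the frontier point \<open>y\<close> into
  \<Omega>.\<close>

lemma tau_minus_forward:
  assumes G: "(y, \<xi>) \<in> Gamma_minus \<Omega>" and t: "0 \<le> t" and D: "(y + t *\<^sub>R \<xi>, \<xi>) \<in> phase_D_bar \<Omega>"
  shows "tau_minus \<Omega> (y + t *\<^sub>R \<xi>) \<xi> = t" "P_in \<Omega> (y + t *\<^sub>R \<xi>) \<xi> = y"
proof -
  let ?x = "y + t *\<^sub>R \<xi>"
  have y: "y \<in> closure \<Omega>" "y \<notin> \<Omega>"
    using G open_dom by (auto simp: Gamma_minus_eq frontier_def interior_open)
  have 1: "t \<le> tau_minus \<Omega> ?x \<xi>"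
    using after_tau_minus[OF D, of t] y by (force simp: algebra_simps)
  have 2: "\<not> t < tau_minus \<Omega> ?x \<xi>"
  proof
    assume lt: "t < tau_minus \<Omega> ?x \<xi>"
    define s where "s = (tau_minus \<Omega> ?x \<xi> - t) / 2"
    have s: "s > 0" using lt by (simp add: s_def)
    have "?x - (t + s) *\<^sub>R \<xi> \<in> \<Omega>"
      using lt t by (intro before_tau_minus[OF D]) (auto simp: s_def field_simps)
    hence ys: "y - s *\<^sub>R \<xi> \<in> \<Omega>" by (simp add: algebra_simps)
    obtain u where u: "u > 0" "y + u *\<^sub>R \<xi> \<in> \<Omega>" using G by (auto simp: Gamma_minus_eq)
    have "(y - s *\<^sub>R \<xi>) + (s + u) *\<^sub>R \<xi> = y + u *\<^sub>R \<xi>"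
      by (simp add: scaleR_left_distrib)
    hence "(y - s *\<^sub>R \<xi>) + (s + u) *\<^sub>R \<xi> \<in> \<Omega>" using u(2) by (simp only:)
    moreover have "y - s *\<^sub>R \<xi> \<in> closure \<Omega>" using ys closure_subset[of \<Omega>] by blast
    ultimately have "(y - s *\<^sub>R \<xi>) + s *\<^sub>R \<xi> \<in> \<Omega>"
      using ray_shrink[of "y - s *\<^sub>R \<xi>" "s + u" \<xi> s] u(1) s by simp
    with y show False by simp
  qed
  show "tau_minus \<Omega> ?x \<xi> = t" using 1 2 by simp
  thus "P_in \<Omega> ?x \<xi> = y" by (simp add: P_in_def)
qed

lemma phase_D_subset: "phase_D \<Omega> \<subseteq> phase_D_bar \<Omega>"
  by (auto simp: phase_D_bar_def)

lemma interior_phase_D: "x \<in> \<Omega> \<Longrightarrow> \<xi> \<in> S1 \<Longrightarrow> (x, \<xi>) \<in> phase_D \<Omega>"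
  by (auto simp: phase_D_def)

text \<open>Points before the exit lie in the open set \<Omega> and points after it in the open
  complement of the closure; both conditions survive small changes of base point and
  direction.\<close>

lemma continuous_on_tau_minus: "continuous_on (phase_D_bar \<Omega>) (\<lambda>(x, \<xi>). tau_minus \<Omega> x \<xi>)"
  unfolding continuous_on_def
proof (safe intro!: order_tendstoI)
  fix x \<xi> a assume D: "(x, \<xi>) \<in> phase_D_bar \<Omega>"
  have lim: "((\<lambda>z. fst z - a *\<^sub>R snd z) \<longlongrightarrow> x - a *\<^sub>R \<xi>) (at (x, \<xi>) within phase_D_bar \<Omega>)" for a
    by (auto intro!: tendsto_eq_intros)
  have inD: "\<forall>\<^sub>F z in at (x, \<xi>) within phase_D_bar \<Omega>. z \<in> phase_D_bar \<Omega>"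
    by (auto simp: eventually_at_filter)
  {
    assume a: "a < tau_minus \<Omega> x \<xi>"
    show "\<forall>\<^sub>F z in at (x, \<xi>) within phase_D_bar \<Omega>. a < (case z of (x, \<xi>) \<Rightarrow> tau_minus \<Omega> x \<xi>)"
    \<comment> \<open>\<open>before_tau_minus\<close> speaks of positive parameters only, so
      negative levels are left to nonnegativity of the exit time.\<close>
    proof (cases "a < 0")
      case True
      show ?thesis
        by (rule eventually_mono[OF inD]) (use tau_minus_nonneg True in force)
    next
      case False
      define b where "b = (a + tau_minus \<Omega> x \<xi>) / 2"
      have b: "a < b" "b < tau_minus \<Omega> x \<xi>" "0 < b" using a False by (auto simp: b_def)
      have "x - b *\<^sub>R \<xi> \<in> \<Omega>" using b by (intro before_tau_minus[OF D]) auto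
      with lim[of b] open_dom have "\<forall>\<^sub>F z in at (x, \<xi>) within phase_D_bar \<Omega>. fst z - b *\<^sub>R snd z \<in> \<Omega>"
        using topological_tendstoD by blast
      with inD show ?thesis
      proof eventually_elim
        case (elim z)
        with after_tau_minus[of "fst z" "snd z" b] closure_subset[of \<Omega>]
        have "\<not> tau_minus \<Omega> (fst z) (snd z) < b" by auto
        with b show ?case by (simp add: case_prod_unfold)
      qed
    qed
  next
    assume a: "tau_minus \<Omega> x \<xi> < a"
    define b where "b = (a + tau_minus \<Omega> x \<xi>) / 2"
    have b: "b < a" "tau_minus \<Omega> x \<xi> < b" using a by (auto simp: b_def)
    have b0: "0 < b" using b tau_minus_nonneg[OF D] by simp
    have "x - b *\<^sub>R \<xi> \<in> - closure \<Omega>" using b after_tau_minus[OF D] by auto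
    moreover have "open (- closure \<Omega>)" by auto
    ultimately have "\<forall>\<^sub>F z in at (x, \<xi>) within phase_D_bar \<Omega>. fst z - b *\<^sub>R snd z \<in> - closure \<Omega>"
      using lim[of b] topological_tendstoD by blast
    with inD show "\<forall>\<^sub>F z in at (x, \<xi>) within phase_D_bar \<Omega>. (case z of (x, \<xi>) \<Rightarrow> tau_minus \<Omega> x \<xi>) < a"
    proof eventually_elim
      case (elim z)
      with before_tau_minus[of "fst z" "snd z" b] b0 closure_subset[of \<Omega>]
      have "\<not> b < tau_minus \<Omega> (fst z) (snd z)" by auto
      with b show ?case by (simp add: case_prod_unfold)
    qed
  }
qed

lemma continuous_on_P_in: "continuous_on (phase_D_bar \<Omega>) (\<lambda>(x, \<xi>). P_in \<Omega> x \<xi>)"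
proof -
  have "continuous_on (phase_D_bar \<Omega>) (\<lambda>z. tau_minus \<Omega> (fst z) (snd z))"
    using continuous_on_tau_minus by (simp add: case_prod_unfold)
  thus ?thesis unfolding P_in_def case_prod_unfold by (intro continuous_intros)
qed

end

subsection \<open>The two boundary arcs\<close>

text \<open>Like a circle without a point, the punctured boundary of a bounded convex set of
  dimension 2 is homeomorphic to a line.\<close>

lemma connected_frontier_minus_point:
  fixes U :: "(real^2) set"
  assumes U: "open U" "convex U" "bounded U" and z: "z \<in> frontier U"
  shows "connected (frontier U - {z})"
proof -
  have ne: "U \<noteq> {}" using z by auto
  have rel: "rel_frontier U = frontier U"
    using U ne by (intro rel_frontier_nonempty_interior) (simp add: interior_open)
  have "aff_dim U = int DIM(real^2)" using U ne by (intro aff_dim_open)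
  hence dim: "aff_dim U = 2" by simp
  obtain a where "(a::real^2) \<noteq> 0" by (metis vector_choose_size zero_less_one norm_zero zero_neq_one zero_le_one)
  hence "aff_dim {x. a \<bullet> x = 0} = 1" by simp
  hence "rel_frontier U - {z} homeomorphic {x. a \<bullet> x = 0}"
    using U z dim rel by (intro homeomorphic_punctured_sphere_affine_gen) (auto simp: affine_hyperplane)
  moreover have "connected {x. a \<bullet> x = 0}" by (intro convex_connected convex_hyperplane)
  ultimately show ?thesis using homeomorphic_connectedness rel by metis
qed

locale cut_boundary = C1_convex_domain +
  fixes \<gamma> A B :: "(real^2) set" and C :: real and I0 :: "(real^2) \<times> (real^2) \<Rightarrow> real"
  assumes cut: "\<gamma> \<subseteq> frontier \<Omega>" "card \<gamma> = 2"
    and arcs: "components (frontier \<Omega> - \<gamma>) = {A, B}" "A \<noteq> B"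
    and data: "\<forall>(x, \<xi>)\<in>Gamma_minus \<Omega>. x \<in> A \<union> \<gamma> \<longrightarrow> I0 (x, \<xi>) = C"
      "\<forall>(x, \<xi>)\<in>Gamma_minus \<Omega>. x \<in> B \<longrightarrow> I0 (x, \<xi>) = 0"
begin

lemma finite_cut: "finite \<gamma>"
  using cut(2) card.infinite by fastforce

lemma frontier_split: "frontier \<Omega> = A \<union> B \<union> \<gamma>"
  using Union_components[of "frontier \<Omega> - \<gamma>"] arcs(1) cut(1) by auto

text \<open>Components are relatively closed in general. Here there are only two, so each is the
  complement of the other and hence relatively open, even in the whole boundary because the cut is
  finite.\<close>

lemma arc_properties:
  assumes "T \<in> {A, B}"
  shows "T \<noteq> {}" "T \<subseteq> frontier \<Omega> - \<gamma>" "closedin (top_of_set (frontier \<Omega> - \<gamma>)) T"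
    "\<exists>U. open U \<and> T = frontier \<Omega> \<inter> U"
proof -
  have TC: "T \<in> components (frontier \<Omega> - \<gamma>)" using assms arcs by simp
  show "T \<noteq> {}" "T \<subseteq> frontier \<Omega> - \<gamma>" "closedin (top_of_set (frontier \<Omega> - \<gamma>)) T"
    using in_components_nonempty[OF TC] in_components_subset[OF TC] closedin_component[OF TC] by auto
  obtain T' where T': "{T, T'} = {A, B}" "T \<noteq> T'" using assms arcs(2) by auto
  hence TC': "T' \<in> components (frontier \<Omega> - \<gamma>)" using arcs by auto
  have disj: "T \<inter> T' = {}" using components_nonoverlap[OF TC TC'] T'(2) by simp
  have "\<Union>{T, T'} = frontier \<Omega> - \<gamma>" using Union_components arcs(1) T'(1) by metis
  hence un: "T \<union> T' = frontier \<Omega> - \<gamma>" by simp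
  obtain K where K: "closed K" "T' = (frontier \<Omega> - \<gamma>) \<inter> K"
    using closedin_component[OF TC'] by (auto simp: closedin_closed)
  have "T = frontier \<Omega> \<inter> (- \<gamma> \<inter> - K)" using un disj K by blast
  moreover have "open (- \<gamma> \<inter> - K)"
    using finite_imp_closed[OF finite_cut] K by (intro open_Int) auto
  ultimately show "\<exists>U. open U \<and> T = frontier \<Omega> \<inter> U" by blast
qed

text \<open>Otherwise the arc would be clopen in \<open>\<partial>\<Omega>\<close> minus the other cut point, which is
  connected.\<close>

lemma cut_in_closure_arc:
  assumes T: "T \<in> {A, B}" and y: "y \<in> \<gamma>"
  shows "y \<in> closure T"
proof (rule ccontr)
  assume ny: "y \<notin> closure T"
  note TP = arc_properties[OF T]
  have "card (\<gamma> - {y}) = 1" using cut(2) y finite_cut by simp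
  then obtain z where z': "\<gamma> - {y} = {z}" by (auto simp: card_1_singleton_iff)
  hence z: "\<gamma> = {y, z}" "y \<noteq> z" using y by auto
  let ?S = "frontier \<Omega> - {z}"
  have con: "connected ?S"
    using connected_frontier_minus_point[OF open_dom convex_dom bounded_dom] cut(1) z by blast
  have TS: "T \<subseteq> ?S" using TP(2) z by blast
  obtain U where U: "open U" "T = frontier \<Omega> \<inter> U" using TP(4) by blast
  have "T = ?S \<inter> U" using U(2) TS by blast
  hence "openin (top_of_set ?S) T" using U(1) by (auto simp: openin_open)
  moreover obtain K where K: "closed K" "T = (frontier \<Omega> - \<gamma>) \<inter> K"
    using TP(3) by (auto simp: closedin_closed)
  have "closure T \<subseteq> K" using K by (intro closure_minimal) auto
  hence "T = ?S \<inter> closure T" using K TS z ny closure_subset[of T] by blast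
  hence "closedin (top_of_set ?S) T" using closedin_closed by (metis closed_closure)
  ultimately have "T = {} \<or> T = ?S" using con unfolding connected_clopen by blast
  moreover have "y \<in> ?S" "y \<notin> T" using y z cut(1) TP(2) by auto
  ultimately show False using TP(1) by blast
qed

text \<open>The ray through \<open>x\<close> is shifted sideways: its entry point is replaced by a
  nearby point of the arc while its length is kept, up to a small shortening if \<open>x\<close> is
  on the outflow boundary.\<close>

lemma approach_nontrivial:
  assumes D: "(x, \<xi>) \<in> phase_D_bar \<Omega>" and P: "P_in \<Omega> x \<xi> \<in> \<gamma>" and T: "T \<in> {A, B}" "T \<subseteq> T1"
  shows "approach \<Omega> T1 x \<xi> \<noteq> bot"
proof -
  define y where "y = P_in \<Omega> x \<xi>"
  define \<tau> where "\<tau> = tau_minus \<Omega> x \<xi>"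
  define S where "S = {x. (x, \<xi>) \<in> phase_D \<Omega> \<and> P_in \<Omega> x \<xi> \<in> T1}"
  have x: "x = y + \<tau> *\<^sub>R \<xi>" by (simp add: y_def \<tau>_def P_in_def)
  have nn: "0 \<le> \<tau>" using tau_minus_nonneg[OF D] by (simp add: \<tau>_def)
  have y: "y \<in> \<gamma>" "(y, \<xi>) \<in> Gamma_minus \<Omega>"
    using P P_in_Gamma_minus[OF D] by (auto simp: y_def)
  have xi: "\<xi> \<in> S1" "norm \<xi> = 1" using phase_D_barD[OF D] by auto
  \<comment> \<open>Reaching \<Omega> after the same distance \<open>s\<close> is what makes the
    nearby arc point an incoming one.\<close>
  have near: "\<exists>a\<in>T. a \<noteq> y \<and> a + s *\<^sub>R \<xi> \<in> \<Omega> \<and> (a, \<xi>) \<in> Gamma_minus \<Omega> \<and> dist a y < e"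
    if "s > 0" "y + s *\<^sub>R \<xi> \<in> \<Omega>" "e > 0" for s e
  proof -
    define W where "W = (\<lambda>a. a + s *\<^sub>R \<xi>) -` \<Omega> \<inter> ball y e"
    have "open W" unfolding W_def
      by (intro open_Int open_vimage open_dom open_ball continuous_intros)
    moreover have "y \<in> W" using that by (simp add: W_def)
    ultimately have "W \<inter> T \<noteq> {}"
      using cut_in_closure_arc[OF T(1) y(1)] closure_iff_nhds_not_empty by blast
    then obtain a where a: "a \<in> W" "a \<in> T" by blast
    have "a \<in> frontier \<Omega>" "a \<noteq> y" using a(2) arc_properties(2)[OF T(1)] y(1) by auto
    moreover have "a + s *\<^sub>R \<xi> \<in> \<Omega>" "dist a y < e" using a(1) by (auto simp: W_def dist_commute)
    ultimately show ?thesis using a(2) \<open>s > 0\<close> xi by (auto simp: Gamma_minus_eq intro!: bexI[of _ a])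
  qed
  have "x islimpt S" unfolding islimpt_approachable
  proof (intro allI impI)
    fix e :: real assume e: "e > 0"
    show "\<exists>x'\<in>S. x' \<noteq> x \<and> dist x' x < e"
    proof (cases "\<tau> = 0")
      case True
      obtain u where u: "u > 0" "y + u *\<^sub>R \<xi> \<in> \<Omega>" using y(2) by (auto simp: Gamma_minus_eq)
      from near[OF u e] obtain a where
        a: "a \<in> T" "a \<noteq> y" "(a, \<xi>) \<in> Gamma_minus \<Omega>" "dist a y < e" by blast
      have "(a, \<xi>) \<in> phase_D \<Omega>" using a(3) by (simp add: phase_D_def)
      moreover have "P_in \<Omega> a \<xi> = a"
        using tau_minus_forward(2)[OF a(3), of 0] calculation phase_D_subset by auto
      ultimately have "a \<in> S" using a(1) T(2) by (auto simp: S_def)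
      thus ?thesis using a x True by auto
    next
      case False
      \<comment> \<open>An outflow boundary point is first pulled back into \<Omega>. The amount
        \<open>min e \<tau> / 2\<close> costs at most half of the distance \<open>e\<close> and
        leaves a positive length.\<close>
      define \<sigma> where "\<sigma> = (if x \<in> \<Omega> then \<tau> else \<tau> - min e \<tau> / 2)"
      have s: "0 < \<sigma>" "\<bar>\<tau> - \<sigma>\<bar> \<le> e / 2" "x \<notin> \<Omega> \<Longrightarrow> \<sigma> < \<tau>"
        using False nn e by (auto simp: \<sigma>_def)
      have "y + \<sigma> *\<^sub>R \<xi> \<in> \<Omega>"
      proof (cases "x \<in> \<Omega>")
        case True
        thus ?thesis by (simp add: \<sigma>_def flip: x)
      next
        case False
        have "x - (\<tau> - \<sigma>) *\<^sub>R \<xi> \<in> \<Omega>"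
          using s False by (intro before_tau_minus[OF D]) (auto simp: \<tau>_def)
        thus ?thesis by (simp add: x algebra_simps)
      qed
      from near[OF s(1) this, of "e / 2"] e obtain a where
        a: "a \<in> T" "a \<noteq> y" "a + \<sigma> *\<^sub>R \<xi> \<in> \<Omega>" "(a, \<xi>) \<in> Gamma_minus \<Omega>" "dist a y < e / 2" by auto
      let ?x' = "a + \<sigma> *\<^sub>R \<xi>"
      have D': "(?x', \<xi>) \<in> phase_D \<Omega>" using interior_phase_D[OF a(3) xi(1)] .
      have "P_in \<Omega> ?x' \<xi> = a"
        using s(1) D' phase_D_subset by (intro tau_minus_forward(2)[OF a(4)]) auto
      hence "?x' \<in> S" using a(1) T(2) D' by (auto simp: S_def)
      moreover have "?x' \<noteq> x"
      proof (cases "x \<in> \<Omega>")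
        case True
        thus ?thesis using a(2) by (subst x) (simp add: \<sigma>_def)
      next
        case False
        thus ?thesis using a(3) by auto
      qed
      moreover have "dist ?x' x < e"
      proof -
        have eq: "?x' - x = (a - y) - (\<tau> - \<sigma>) *\<^sub>R \<xi>" by (simp add: x algebra_simps)
        have "dist ?x' x \<le> dist a y + \<bar>\<tau> - \<sigma>\<bar>"
          using norm_triangle_ineq4[of "a - y" "(\<tau> - \<sigma>) *\<^sub>R \<xi>"] xi unfolding dist_norm eq by simp
        thus ?thesis using a(5) s(2) by simp
      qed
      ultimately show ?thesis by blast
    qed
  qed
  thus ?thesis unfolding approach_def S_def by (simp add: trivial_limit_within)
qed

text \<open>The arcs are relatively open in the boundary and the entry point varies continuously, so
  nearby rays start on the same arc.\<close>

lemma data_locally_constant: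
  assumes D: "(x, \<xi>) \<in> phase_D_bar \<Omega>" and P: "P_in \<Omega> x \<xi> \<notin> \<gamma>"
  shows "continuous (at (x, \<xi>) within phase_D_bar \<Omega>) (\<lambda>(x, \<xi>). I0 (P_in \<Omega> x \<xi>, \<xi>))"
proof -
  define F where "F = at (x, \<xi>) within phase_D_bar \<Omega>"
  have "P_in \<Omega> x \<xi> \<in> A \<union> B" using P_in_frontier[OF D] frontier_split P by blast
  then obtain T where T: "T \<in> {A, B}" "P_in \<Omega> x \<xi> \<in> T" by blast
  obtain c where c: "\<And>z. z \<in> Gamma_minus \<Omega> \<Longrightarrow> fst z \<in> T \<Longrightarrow> I0 z = c"
  proof (cases "T = A")
    case True
    have "I0 z = C" if "z \<in> Gamma_minus \<Omega>" "fst z \<in> T" for z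
      using bspec[OF data(1) that(1)] that(2) True by (simp add: case_prod_unfold)
    thus ?thesis using that by blast
  next
    case False
    have "I0 z = 0" if "z \<in> Gamma_minus \<Omega>" "fst z \<in> T" for z
      using bspec[OF data(2) that(1)] that(2) T(1) False by (simp add: case_prod_unfold)
    thus ?thesis using that by blast
  qed
  obtain U where U: "open U" "T = frontier \<Omega> \<inter> U" using arc_properties(4)[OF T(1)] by blast
  have "((\<lambda>(x, \<xi>). P_in \<Omega> x \<xi>) \<longlongrightarrow> P_in \<Omega> x \<xi>) F"
    using continuous_on_P_in D unfolding continuous_on_def F_def by fastforce
  hence "\<forall>\<^sub>F z in F. (case z of (x, \<xi>) \<Rightarrow> P_in \<Omega> x \<xi>) \<in> U"
    using topological_tendstoD U T(2) by blast
  moreover have "\<forall>\<^sub>F z in F. z \<in> phase_D_bar \<Omega>" by (auto simp: eventually_at_filter F_def)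
  ultimately have "\<forall>\<^sub>F z in F. (\<lambda>(x, \<xi>). I0 (P_in \<Omega> x \<xi>, \<xi>)) z = c"
  proof eventually_elim
    case (elim z)
    obtain x' \<xi>' where z: "z = (x', \<xi>')" by (cases z)
    have "P_in \<Omega> x' \<xi>' \<in> T" using P_in_frontier elim U z by auto
    with c[of "(P_in \<Omega> x' \<xi>', \<xi>')"] P_in_Gamma_minus elim z show ?case by auto
  qed
  hence "((\<lambda>(x, \<xi>). I0 (P_in \<Omega> x \<xi>, \<xi>)) \<longlongrightarrow> c) F" by (rule tendsto_eventually)
  moreover have "I0 (P_in \<Omega> x \<xi>, \<xi>) = c"
    using c[OF P_in_Gamma_minus[OF D]] T by simp
  ultimately show ?thesis by (simp add: continuous_within F_def)
qed

end

subsection \<open>The circle measure and exponential attenuation\<close>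

lemma space_circle_measure [simp]: "space circle_measure = S1"
  by (simp add: circle_measure_def space_restrict_space)

lemma sets_circle_measure [measurable_cong]: "sets circle_measure = sets (restrict_space borel S1)"
  by (simp add: circle_measure_def)

lemma measurable_circle_param [measurable]:
  "(\<lambda>t. vector [cos t, sin t] :: real^2) \<in> restrict_space lborel {0..<2*pi} \<rightarrow>\<^sub>M restrict_space borel S1"
proof (rule measurable_restrict_space2)
  show "(\<lambda>t. vector [cos t, sin t] :: real^2) \<in> space (restrict_space lborel {0..<2*pi}) \<rightarrow> S1"
    by (simp add: norm_vec_def L2_set_def sum_2)
  have eq: "(\<lambda>t. vector [cos t, sin t] :: real^2) = (\<lambda>t. cos t *\<^sub>R axis 1 1 + sin t *\<^sub>R axis 2 1)"
    by (simp add: fun_eq_iff vec_eq_iff forall_2 axis_def)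
  have "continuous_on UNIV (\<lambda>t. vector [cos t, sin t] :: real^2)"
    by (subst eq) (intro continuous_intros)
  hence "(\<lambda>t. vector [cos t, sin t] :: real^2) \<in> borel_measurable lborel"
    by (simp add: borel_measurable_continuous_onI)
  thus "(\<lambda>t. vector [cos t, sin t] :: real^2) \<in> borel_measurable (restrict_space lborel {0..<2*pi})"
    by (rule measurable_restrict_space1)
qed

interpretation circle_measure: finite_measure circle_measure
proof -
  interpret finite_measure "restrict_space lborel {0..<2*pi}"
    by (rule finite_measureI) (simp add: space_restrict_space emeasure_restrict_space)
  show "finite_measure circle_measure"
    unfolding circle_measure_def by (intro finite_measure_distr measurable_circle_param)
qed

text \<open>Angles of the same point differ by multiples of \<open>2 * pi\<close>, so the
  parametrisation has countable fibres.\<close>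

lemma AE_circle_measure_finite:
  assumes "finite N"
  shows "AE \<xi> in circle_measure. \<xi> \<notin> N"
proof -
  have "AE \<xi> in circle_measure. \<xi> \<noteq> v" if v: "v \<in> S1" for v
  proof -
    let ?f = "\<lambda>t. vector [cos t, sin t] :: real^2"
    have "countable {t. ?f t = v}"
    proof (cases "\<exists>t0. ?f t0 = v")
      case True
      then obtain t0 where t0: "?f t0 = v" by blast
      have "{t. ?f t = v} \<subseteq> range (\<lambda>n::int. t0 + 2 * pi * of_int n)"
      proof
        fix t assume "t \<in> {t. ?f t = v}"
        hence "?f t = ?f t0" using t0 by simp
        hence "sin t = sin t0 \<and> cos t = cos t0" by (simp add: vec_eq_iff forall_2)
        thus "t \<in> range (\<lambda>n::int. t0 + 2 * pi * of_int n)" unfolding sin_cos_eq_iff by auto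
      qed
      thus ?thesis by (rule countable_subset) simp
    qed simp
    from AE_not_in[OF countable_imp_null_set_lborel[OF this]]
    have "AE t in lborel. ?f t \<noteq> v" by simp
    hence "AE t in restrict_space lborel {0..<2*pi}. ?f t \<noteq> v"
      by (subst AE_restrict_space_iff) auto
    moreover have "{x \<in> space (restrict_space borel S1). x \<noteq> v} \<in> sets (restrict_space borel S1)"
      by (auto simp: space_restrict_space sets_restrict_space intro!: image_eqI[of _ _ "- {v}"])
    ultimately show ?thesis
      unfolding circle_measure_def by (subst AE_distr_iff) auto
  qed
  moreover have "AE \<xi> in circle_measure. \<xi> \<noteq> v" if "v \<notin> S1" for v
    using that by (intro AE_I2) auto
  ultimately have "\<forall>v\<in>N. AE \<xi> in circle_measure. \<xi> \<noteq> v" by blast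
  hence "AE \<xi> in circle_measure. \<forall>v\<in>N. \<xi> \<noteq> v"
    by (rule AE_ball_countable[OF countable_finite[OF assms], THEN iffD2])
  thus ?thesis by eventually_elim auto
qed

lemma borel_measurable_circle:
  fixes h :: "real^2 \<Rightarrow> real"
  assumes "finite N" "continuous_on (S1 - N) h"
  shows "h \<in> borel_measurable circle_measure"
proof -
  have "h \<in> borel_measurable (restrict_space borel (S1 - N))"
    using assms(2) by (rule borel_measurable_continuous_on_restrict)
  moreover have "S1 \<inter> - (N \<inter> S1) = S1 - N" by blast
  moreover have "- (N \<inter> S1) \<in> sets borel"
    using assms(1) by (simp add: finite_imp_closed borel_closed borel_comp)
  ultimately have "h \<in> borel_measurable (restrict_space (restrict_space borel S1) (- (N \<inter> S1)))"
    by (subst restrict_restrict_space) (simp_all del: Compl_Int)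
  hence "h \<in> borel_measurable (restrict_space borel S1)"
    using assms(1)
    by (intro measurable_restrict_countable[of "N \<inter> S1" "restrict_space borel S1" h borel])
       (auto simp: sets_restrict_space_iff countable_finite)
  thus ?thesis by (simp add: measurable_cong_sets[OF sets_circle_measure refl])
qed

section \<open>Bounded integrands on intervals and attenuation along one ray\<close>

lemma set_integrable_bounded:
  fixes g :: "real \<Rightarrow> real"
  assumes "g \<in> borel_measurable borel" "\<And>t. \<bar>g t\<bar> \<le> m"
  shows "set_integrable lborel {a..b} g"
  unfolding set_integrable_def
proof (rule Bochner_Integration.integrable_bound)
  show "integrable lborel (\<lambda>t. m * indicator {a..b} t)"
    by (intro integrable_mult_right integrable_real_indicator) (auto simp: emeasure_lborel_Icc_eq)
  show "AE t in lborel. norm (indicator {a..b} t *\<^sub>R g t) \<le> norm (m * indicator {a..b} t)"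
    using assms(2) by (intro AE_I2) (auto simp: indicator_def intro: order_trans[OF assms(2) abs_ge_self])
qed (use assms(1) in simp)

lemma set_integral_increment:
  fixes g :: "real \<Rightarrow> real"
  assumes "g \<in> borel_measurable borel" "\<And>t. \<bar>g t\<bar> \<le> m" "0 \<le> a" "a \<le> b"
  shows "(LINT t:{0..b}|lborel. g t) - (LINT t:{0..a}|lborel. g t) = (LINT t:{a..b}|lborel. g t)"
proof -
  note S = set_borel_integral_eq_integral[OF set_integrable_bounded[OF assms(1,2)]]
  show ?thesis unfolding S(2)
    using Henstock_Kurzweil_Integration.integral_combine[OF assms(3,4) S(1)] by simp
qed

text \<open>Substitutes for the fundamental theorem of calculus below, where the absorption coefficient is
  merely measurable, so that the two integrals need not be differentiable separately.\<close>

lemma zero_derivative_quadratic: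
  fixes f :: "real \<Rightarrow> real"
  assumes "\<And>s t. s \<in> S \<Longrightarrow> t \<in> S \<Longrightarrow> s \<le> t \<Longrightarrow> \<bar>f t - f s\<bar> \<le> K * (t - s)\<^sup>2" and x: "x \<in> S"
  shows "(f has_field_derivative 0) (at x within S)"
proof -
  have le: "\<bar>f t - f x\<bar> \<le> K * (t - x)\<^sup>2" if "t \<in> S" for t
    using assms(1)[OF x that] assms(1)[OF that x] linear[of x t]
    by (auto simp: power2_commute abs_minus_commute)
  have "((\<lambda>y. (f y - f x) / (y - x)) \<longlongrightarrow> 0) (at x within S)"
  proof (rule Lim_null_comparison)
    show "\<forall>\<^sub>F y in at x within S. norm ((f y - f x) / (y - x)) \<le> K * \<bar>y - x\<bar>"
    proof -
      have "norm ((f y - f x) / (y - x)) \<le> K * \<bar>y - x\<bar>" if "y \<in> S" "y \<noteq> x" for y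
        using le[OF that(1)] that(2)
        by (simp add: abs_divide pos_divide_le_eq power2_eq_square mult.assoc)
      thus ?thesis by (auto simp: eventually_at_filter)
    qed
    have "((\<lambda>y. K * \<bar>y - x\<bar>) \<longlongrightarrow> K * \<bar>x - x\<bar>) (at x within S)" by (intro tendsto_intros)
    thus "((\<lambda>y. K * \<bar>y - x\<bar>) \<longlongrightarrow> 0) (at x within S)" by simp
  qed
  thus ?thesis by (simp add: has_field_derivative_iff)
qed

text \<open>Both are \<open>1 + x \<le> exp x\<close>, taken at \<open>b - a\<close> and at
  \<open>a - b\<close>. The decrement is thus enclosed by the two end point slopes, as the
  attenuated integral will be.\<close>

lemma exp_minus_increment:
  fixes a b :: real
  assumes "a \<le> b"
  shows "exp (- b) * (b - a) \<le> exp (- a) - exp (- b)" "exp (- a) - exp (- b) \<le> exp (- a) * (b - a)"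
proof -
  have "exp (- b) * (1 + (b - a)) \<le> exp (- b) * exp (b - a)"
    by (intro mult_left_mono exp_ge_add_one_self) auto
  thus "exp (- b) * (b - a) \<le> exp (- a) - exp (- b)"
    by (simp add: algebra_simps flip: exp_add)
  have "exp (- a) * (1 + (a - b)) \<le> exp (- a) * exp (a - b)"
    by (intro mult_left_mono exp_ge_add_one_self) auto
  thus "exp (- a) - exp (- b) \<le> exp (- a) * (b - a)"
    by (simp add: algebra_simps flip: exp_add)
qed

text \<open>The coefficient along one ray. Rays inside an interface are included, so nothing beyond
  measurability is available.\<close>

locale absorption =
  fixes g :: "real \<Rightarrow> real" and m :: real
  assumes meas [measurable]: "g \<in> borel_measurable borel"
    and nonneg: "0 \<le> g t" and le: "g t \<le> m"
begin

text \<open>The optical depth of the ray. The interval is empty for negative \<open>s\<close>, which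
  makes the function monotone on the whole line.\<close>

definition depth :: "real \<Rightarrow> real" where "depth s = (LINT t:{0..s}|lborel. g t)"

lemma abs_le: "\<bar>g t\<bar> \<le> m" using nonneg le by simp

lemma depth_increment:
  assumes "0 \<le> a" "a \<le> b"
  shows "depth b - depth a = (LINT t:{a..b}|lborel. g t)"
  unfolding depth_def by (rule set_integral_increment[OF meas abs_le assms])

lemma integral_bounds: 
  assumes "a \<le> b" 
  shows "0 \<le> (LINT t:{a..b}|lborel. g t)" "(LINT t:{a..b}|lborel. g t) \<le> m * (b - a)"
proof -
  show "0 \<le> (LINT t:{a..b}|lborel. g t)"
    unfolding set_lebesgue_integral_def by (intro integral_nonneg_AE AE_I2) (simp add: nonneg)
  have "(LINT t:{a..b}|lborel. g t) \<le> (LINT t:{a..b}|lborel. m)"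
    by (intro set_integral_mono set_integrable_bounded[OF meas abs_le]
        set_integrable_bounded[of _ "\<bar>m\<bar>"] le) auto
  thus "(LINT t:{a..b}|lborel. g t) \<le> m * (b - a)"
    using assms by (simp add: set_lebesgue_integral_def mult.commute)
qed

lemma depth_mono: "0 \<le> a \<Longrightarrow> a \<le> b \<Longrightarrow> depth a \<le> depth b"
  using depth_increment[of a b] integral_bounds[of a b] by simp

lemma depth_Lipschitz: "0 \<le> a \<Longrightarrow> a \<le> b \<Longrightarrow> depth b - depth a \<le> m * (b - a)"
  using depth_increment[of a b] integral_bounds[of a b] by simp

lemma depth_nonpos: "s \<le> 0 \<Longrightarrow> depth s = 0"
  unfolding depth_def set_lebesgue_integral_def
  by (intro integral_eq_zero_AE AE_I[of _ _ "{0}"]) (auto simp: indicator_def)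

lemma depth_nonneg: "0 \<le> depth s"
  unfolding depth_def set_lebesgue_integral_def
  by (intro integral_nonneg_AE AE_I2) (simp add: nonneg)

lemma depth_le: "0 \<le> s \<Longrightarrow> depth s \<le> m * s"
  using depth_Lipschitz[of 0 s] depth_nonpos[of 0] by simp

lemma measurable_depth [measurable]: "depth \<in> borel_measurable borel"
proof (rule borel_measurable_mono, rule monoI)
  fix a b :: real assume "a \<le> b"
  thus "depth a \<le> depth b"
    using depth_mono[of a b] depth_nonpos[of a] depth_nonneg[of b] by (cases "0 \<le> a") auto
qed

lemma attenuated_bounded: "\<bar>g s * exp (- depth s)\<bar> \<le> m"
proof -
  have "g s * exp (- depth s) \<le> g s * 1"
    using depth_nonneg nonneg by (intro mult_left_mono) auto
  thus ?thesis using nonneg[of s] le[of s] by (simp add: abs_mult)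
qed

text \<open>The integral plus \<open>exp (- depth)\<close> has increments of second order in the
  step, hence derivative zero, hence is constant. No pointwise derivative of either summand is
  needed.\<close>

lemma integral_attenuated:
  assumes T: "0 \<le> T"
  shows "(LINT s:{0..T}|lborel. g s * exp (- depth s)) = 1 - exp (- depth T)"
proof -
  define u where "u t = (LINT s:{0..t}|lborel. g s * exp (- depth s))" for t
  define f where "f t = u t + exp (- depth t)" for t
  have m: "(\<lambda>s. g s * exp (- depth s)) \<in> borel_measurable borel" by measurable
  have quad: "\<bar>f t - f s\<bar> \<le> (m * m) * (t - s)\<^sup>2" if st: "0 \<le> s" "s \<le> t" for s t
  proof -
    let ?\<Delta> = "depth t - depth s"
    have D: "0 \<le> ?\<Delta>" "?\<Delta> \<le> m * (t - s)" using depth_mono[OF st] depth_Lipschitz[OF st] by auto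
    have eq: "u t - u s = (LINT r:{s..t}|lborel. g r * exp (- depth r))"
      unfolding u_def by (rule set_integral_increment[OF m attenuated_bounded st])
    have int: "set_integrable lborel {s..t} (\<lambda>r. g r * c)" for c
      using meas abs_le by (intro set_integrable_bounded[of _ "m * \<bar>c\<bar>"]) (auto simp: abs_mult intro!: mult_right_mono)
    have "u t - u s \<le> (LINT r:{s..t}|lborel. g r * exp (- depth s))" unfolding eq
      using st by (intro set_integral_mono int set_integrable_bounded[OF m attenuated_bounded] mult_left_mono)
         (auto intro: depth_mono nonneg)
    hence 1: "u t - u s \<le> ?\<Delta> * exp (- depth s)"
      by (simp add: depth_increment[OF st])
    have "(LINT r:{s..t}|lborel. g r * exp (- depth t)) \<le> u t - u s" unfolding eq
      using st by (intro set_integral_mono int set_integrable_bounded[OF m attenuated_bounded] mult_left_mono)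
         (auto intro: depth_mono nonneg)
    hence 2: "?\<Delta> * exp (- depth t) \<le> u t - u s"
      by (simp add: depth_increment[OF st])
    note E = exp_minus_increment[of "depth s" "depth t"]
    \<comment> \<open>The increment of \<open>u\<close> and the decrement of
      \<open>exp (- depth)\<close> both lie between \<open>?\<Delta> * exp (- depth t)\<close> and
      \<open>?\<Delta> * exp (- depth s)\<close>, so they differ by at most the length of that
      interval.\<close>
    have "\<bar>f t - f s\<bar> \<le> ?\<Delta> * (exp (- depth s) - exp (- depth t))"
      using 1 2 E D(1) unfolding f_def abs_le_iff by (simp add: algebra_simps)
    also have "\<dots> \<le> ?\<Delta> * (exp (- depth s) * ?\<Delta>)"
      using E D(1) by (intro mult_left_mono) auto
    also have "\<dots> \<le> ?\<Delta> * (1 * ?\<Delta>)"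
      using D(1) depth_nonneg by (intro mult_left_mono mult_right_mono) auto
    also have "\<dots> \<le> (m * (t - s)) * (m * (t - s))"
      using D by (simp add: mult_mono)
    finally show ?thesis by (simp add: power2_eq_square algebra_simps)
  qed
  have "\<exists>c. \<forall>t\<in>{0..T}. f t = c"
  proof (rule has_field_derivative_zero_constant)
    fix x assume "x \<in> {0..T}"
    thus "(f has_field_derivative 0) (at x within {0..T})"
      using quad by (intro zero_derivative_quadratic[where K = "m * m"]) auto
  qed simp
  hence "f T = f 0" using T by (metis atLeastAtMost_iff order_refl)
  moreover have "u 0 = 0" unfolding u_def set_lebesgue_integral_def
    by (intro integral_eq_zero_AE AE_I[of _ _ "{0}"]) (auto simp: indicator_def)
  ultimately show ?thesis by (simp add: f_def u_def depth_nonpos)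
qed

end

subsection \<open>Integration along rays\<close>

lemma borel_measurable_open_support:
  fixes k :: "'a::topological_space \<Rightarrow> real"
  assumes "open U" "continuous_on U k" "\<And>y. y \<notin> U \<Longrightarrow> k y = 0"
  shows "k \<in> borel_measurable borel"
proof -
  have "k = (\<lambda>y. indicator U y *\<^sub>R k y)" using assms(3) by (auto simp: fun_eq_iff indicator_def)
  moreover have "(\<lambda>y. indicator U y *\<^sub>R k y) \<in> borel_measurable borel"
    using assms by (intro borel_measurable_continuous_on_indicator) auto
  ultimately show ?thesis by simp
qed

lemma set_integral_extend_zero:
  fixes g :: "real \<Rightarrow> real"
  assumes "a \<le> b" "\<And>t. a < t \<Longrightarrow> g t = 0"
  shows "(LINT t:{0..a}|lborel. g t) = (LINT t:{0..b}|lborel. g t)"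
  unfolding set_lebesgue_integral_def
  using assms by (intro Bochner_Integration.integral_cong) (auto simp: indicator_def not_le)

lemma set_integral_dominated_convergence:
  fixes g :: "real \<Rightarrow> real" and g' :: "nat \<Rightarrow> real \<Rightarrow> real"
  assumes "g \<in> borel_measurable borel" "\<And>n. g' n \<in> borel_measurable borel"
    and "AE t in lborel. t \<in> {a..b} \<longrightarrow> (\<lambda>n. g' n t) \<longlonglongrightarrow> g t"
    and "\<And>n t. t \<in> {a..b} \<Longrightarrow> \<bar>g' n t\<bar> \<le> c"
  shows "(\<lambda>n. LINT t:{a..b}|lborel. g' n t) \<longlonglongrightarrow> (LINT t:{a..b}|lborel. g t)"
  unfolding set_lebesgue_integral_def
proof (rule integral_dominated_convergence)
  show "integrable lborel (\<lambda>t. c * indicator {a..b} t)"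
    by (intro integrable_mult_right integrable_real_indicator) (auto simp: emeasure_lborel_Icc_eq)
  show "AE t in lborel. (\<lambda>n. indicator {a..b} t *\<^sub>R g' n t) \<longlonglongrightarrow> indicator {a..b} t *\<^sub>R g t"
    using assms(3) by eventually_elim (auto simp: indicator_def)
  show "AE t in lborel. norm (indicator {a..b} t *\<^sub>R g' n t) \<le> c * indicator {a..b} t" for n
    using assms(4) by (intro AE_I2) (auto simp: indicator_def)
qed (use assms(1,2) in simp_all)

text \<open>\<open>E\<close> collects the finitely many directions of the straight interfaces. Since the coefficients
  vanish off \<open>\<Omega>0\<close>, all integrals along backward rays may be taken up to the fixed length \<open>R\<close>,
  which avoids a moving end point under limits.\<close>

locale transport_medium = C1_convex_domain +
  fixes \<Omega>0 E :: "(real^2) set" and \<mu>t \<mu>s :: "real^2 \<Rightarrow> real"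
    and p :: "real^2 \<Rightarrow> real^2 \<Rightarrow> real^2 \<Rightarrow> real" and m pb R :: real
  assumes open_Omega0: "open \<Omega>0" and Omega0_subset: "\<Omega>0 \<subseteq> \<Omega>" and finite_E: "finite E"
    and null_lines: "\<And>x \<xi>. \<xi> \<in> S1 - E \<Longrightarrow> {t. x - t *\<^sub>R \<xi> \<in> \<Omega> - \<Omega>0} \<in> null_sets lborel"
    and mu_nonneg: "0 \<le> \<mu>s x" and mu_le: "\<mu>s x \<le> \<mu>t x" and mu_bound: "\<mu>t x \<le> m"
    and mu_cont: "continuous_on \<Omega>0 \<mu>t" "continuous_on \<Omega>0 \<mu>s"
    and mu_zero: "x \<notin> \<Omega>0 \<Longrightarrow> \<mu>t x = 0" "x \<notin> \<Omega>0 \<Longrightarrow> \<mu>s x = 0"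
    and p_nonneg: "\<xi> \<in> S1 \<Longrightarrow> \<xi>' \<in> S1 \<Longrightarrow> 0 \<le> p x \<xi> \<xi>'"
    and p_le: "\<xi> \<in> S1 \<Longrightarrow> \<xi>' \<in> S1 \<Longrightarrow> p x \<xi> \<xi>' \<le> pb"
    and p_cont: "continuous_on (\<Omega>0 \<times> S1 \<times> S1) (\<lambda>(x, \<xi>, \<xi>'). p x \<xi> \<xi>')"
    and p_total: "x \<in> \<Omega>0 \<Longrightarrow> \<xi> \<in> S1 \<Longrightarrow> (LINT \<xi>'|circle_measure. p x \<xi> \<xi>') = 1"
    and R_nonneg: "0 \<le> R"
    and beyond_R: "x \<in> closure \<Omega> \<Longrightarrow> \<xi> \<in> S1 \<Longrightarrow> R < t \<Longrightarrow> x - t *\<^sub>R \<xi> \<notin> \<Omega>"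
begin

definition regular :: "((real^2) \<times> (real^2)) set" where
  "regular = phase_D_bar \<Omega> \<inter> UNIV \<times> (- E)"

text \<open>The weight \<open>\<mu>s\<close> is left to \<open>stream\<close>. Averaging against
  \<open>p\<close>, of total mass 1, does not enlarge a bound.\<close>

definition scatter :: "((real^2) \<times> (real^2) \<Rightarrow> real) \<Rightarrow> (real^2) \<times> (real^2) \<Rightarrow> real" where
  "scatter f = (\<lambda>(x, \<xi>). LINT \<xi>'|circle_measure. p x \<xi> \<xi>' * f (x, \<xi>'))"

definition stream :: "((real^2) \<times> (real^2) \<Rightarrow> real) \<Rightarrow> (real^2) \<times> (real^2) \<Rightarrow> real" where
  "stream H = (\<lambda>(x, \<xi>). LINT s:{0..R}|lborel.
     \<mu>s (x - s *\<^sub>R \<xi>) * exp (- M_t \<mu>t x \<xi> s) * H (x - s *\<^sub>R \<xi>, \<xi>))"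

lemma m_nonneg: "0 \<le> m"
  using mu_nonneg[of 0] mu_le[of 0] mu_bound[of 0] by linarith

lemma measurable_mu [measurable]: "\<mu>t \<in> borel_measurable borel" "\<mu>s \<in> borel_measurable borel"
  using borel_measurable_open_support[OF open_Omega0] mu_cont mu_zero by auto

lemma measurable_line [measurable]: "(\<lambda>s. x - s *\<^sub>R \<xi>) \<in> borel_measurable borel" for x \<xi> :: "real^2"
  by measurable

lemma absorption_line: "absorption (\<lambda>r. \<mu>t (x - r *\<^sub>R \<xi>)) m"
proof
  show "(\<lambda>r. \<mu>t (x - r *\<^sub>R \<xi>)) \<in> borel_measurable borel" by measurable
  show "0 \<le> \<mu>t (x - t *\<^sub>R \<xi>)" for t
    using mu_nonneg mu_le by (rule order_trans)
  show "\<mu>t (x - t *\<^sub>R \<xi>) \<le> m" for t by (rule mu_bound)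
qed

lemma M_t_depth: "M_t \<mu>t x \<xi> = absorption.depth (\<lambda>r. \<mu>t (x - r *\<^sub>R \<xi>))"
  by (simp add: fun_eq_iff M_t_def absorption.depth_def[OF absorption_line])

lemmas M_t_nonneg = absorption.depth_nonneg[OF absorption_line, folded M_t_depth]
  and M_t_le = absorption.depth_le[OF absorption_line, folded M_t_depth]
  and measurable_M_t [measurable] = absorption.measurable_depth[OF absorption_line, folded M_t_depth]
  and integral_attenuated = absorption.integral_attenuated[OF absorption_line, folded M_t_depth]

lemma tau_minus_le_R:
  assumes D: "(x, \<xi>) \<in> phase_D_bar \<Omega>"
  shows "tau_minus \<Omega> x \<xi> \<le> R"
proof (rule ccontr)
  assume "\<not> tau_minus \<Omega> x \<xi> \<le> R"
  hence "R < (R + tau_minus \<Omega> x \<xi>) / 2" "(R + tau_minus \<Omega> x \<xi>) / 2 < tau_minus \<Omega> x \<xi>" by auto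
  moreover from this have "0 < (R + tau_minus \<Omega> x \<xi>) / 2" using R_nonneg by linarith
  ultimately show False
    using before_tau_minus[OF D] beyond_R[OF phase_D_barD(1,2)[OF D]] by blast
qed

lemma after_tau_minus_Omega0:
  assumes "(x, \<xi>) \<in> phase_D_bar \<Omega>" "tau_minus \<Omega> x \<xi> < t"
  shows "x - t *\<^sub>R \<xi> \<notin> \<Omega>0"
  using after_tau_minus[OF assms] closure_subset[of \<Omega>] Omega0_subset by blast

lemma M_t_tau_minus:
  assumes D: "(x, \<xi>) \<in> phase_D_bar \<Omega>"
  shows "M_t \<mu>t x \<xi> (tau_minus \<Omega> x \<xi>) = M_t \<mu>t x \<xi> R"
  unfolding M_t_def using tau_minus_le_R[OF D] after_tau_minus_Omega0[OF D] mu_zero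
  by (intro set_integral_extend_zero) auto

lemma stream_tau_minus:
  assumes D: "(x, \<xi>) \<in> phase_D_bar \<Omega>"
  shows "(LINT s:{0..tau_minus \<Omega> x \<xi>}|lborel.
     \<mu>s (x - s *\<^sub>R \<xi>) * exp (- M_t \<mu>t x \<xi> s) * H (x - s *\<^sub>R \<xi>, \<xi>)) = stream H (x, \<xi>)"
  unfolding stream_def prod.case using tau_minus_le_R[OF D] after_tau_minus_Omega0[OF D] mu_zero
  by (intro set_integral_extend_zero) auto

lemma regularD:
  assumes "(x, \<xi>) \<in> regular"
  shows "(x, \<xi>) \<in> phase_D_bar \<Omega>" "\<xi> \<in> S1 - E" "\<xi> \<in> S1"
  using assms phase_D_barD(2) by (auto simp: regular_def)

text \<open>The target set is where the coefficients, extended by zero, are continuous as functions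
  on the plane: \<open>\<Omega>0\<close>, and the exterior, where they vanish nearby. A regular ray
  otherwise meets only the interface, in a null set, and the outer boundary at no more than two
  parameters.\<close>

lemma AE_line:
  assumes "(x, \<xi>) \<in> regular"
  shows "AE s in lborel. 0 \<le> s \<longrightarrow> x - s *\<^sub>R \<xi> \<in> \<Omega>0 \<union> - closure \<Omega>"
proof -
  note D = regularD[OF assms]
  have "AE s in lborel. s \<notin> {t. x - t *\<^sub>R \<xi> \<in> \<Omega> - \<Omega>0}"
    by (rule AE_not_in[OF null_lines[OF D(2)]])
  moreover have "AE s in lborel. s \<notin> {0, tau_minus \<Omega> x \<xi>}"
    by (intro AE_not_in finite_imp_null_set_lborel) auto
  ultimately show ?thesis
  proof eventually_elim
    case (elim s)
    have "x - s *\<^sub>R \<xi> \<notin> frontier \<Omega>" if "0 \<le> s"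
      using frontier_on_ray[OF D(1) that] elim(2) by blast
    thus ?case using elim(1) open_dom by (auto simp: frontier_def interior_open)
  qed
qed

lemma ray_limit:
  fixes k :: "(real^2) \<times> (real^2) \<Rightarrow> real"
  assumes k: "continuous_on (\<Omega>0 \<times> S1) k" "\<And>y \<eta>. y \<notin> \<Omega>0 \<Longrightarrow> k (y, \<eta>) = 0"
    and u: "u \<longlonglongrightarrow> (x, \<xi>)" "\<And>n. snd (u n) \<in> S1" "\<xi> \<in> S1"
    and s: "x - s *\<^sub>R \<xi> \<in> \<Omega>0 \<union> - closure \<Omega>"
  shows "(\<lambda>n. k (fst (u n) - s *\<^sub>R snd (u n), snd (u n))) \<longlonglongrightarrow> k (x - s *\<^sub>R \<xi>, \<xi>)"
proof -
  have lim1: "(\<lambda>n. fst (u n) - s *\<^sub>R snd (u n)) \<longlonglongrightarrow> x - s *\<^sub>R \<xi>"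
    and lim2: "(\<lambda>n. snd (u n)) \<longlonglongrightarrow> \<xi>"
    using tendsto_fst[OF u(1)] tendsto_snd[OF u(1)] by (auto intro!: tendsto_intros)
  show ?thesis
  proof (cases "x - s *\<^sub>R \<xi> \<in> \<Omega>0")
    case True
    have "\<forall>\<^sub>F n in sequentially. fst (u n) - s *\<^sub>R snd (u n) \<in> \<Omega>0"
      using topological_tendstoD[OF lim1 open_Omega0 True] .
    hence "\<forall>\<^sub>F n in sequentially. (fst (u n) - s *\<^sub>R snd (u n), snd (u n)) \<in> \<Omega>0 \<times> S1"
      by eventually_elim (use u in auto)
    thus ?thesis
      using True u(3) by (intro continuous_on_tendsto_compose[OF k(1)] tendsto_Pair lim1 lim2) auto
  next
    case False
    hence "x - s *\<^sub>R \<xi> \<in> - closure \<Omega>" using s by blast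
    from topological_tendstoD[OF lim1 open_Compl[OF closed_closure] this]
    have "\<forall>\<^sub>F n in sequentially. fst (u n) - s *\<^sub>R snd (u n) \<in> - closure \<Omega>" .
    hence "\<forall>\<^sub>F n in sequentially. k (fst (u n) - s *\<^sub>R snd (u n), snd (u n)) = 0"
    proof eventually_elim
      case (elim n)
      thus ?case using k(2) closure_subset[of \<Omega>] Omega0_subset by blast
    qed
    thus ?thesis using k(2)[OF False] by (simp add: tendsto_eventually)
  qed
qed

lemma regular_limit:
  assumes "u \<longlonglongrightarrow> (x, \<xi>)" "\<And>n. u n \<in> regular" "(x, \<xi>) \<in> regular"
    and "continuous_on (\<Omega>0 \<times> S1) k" "\<And>y \<eta>. y \<notin> \<Omega>0 \<Longrightarrow> k (y, \<eta>) = 0"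
  shows "AE s in lborel. 0 \<le> s \<longrightarrow>
    (\<lambda>n. k (fst (u n) - s *\<^sub>R snd (u n), snd (u n))) \<longlonglongrightarrow> (k (x - s *\<^sub>R \<xi>, \<xi>) :: real)"
proof -
  have S: "snd (u n) \<in> S1" for n using regularD(3)[of "fst (u n)" "snd (u n)"] assms(2) by simp
  show ?thesis using AE_line[OF assms(3)]
  proof eventually_elim
    case (elim s)
    thus ?case using ray_limit[OF assms(4,5,1) S regularD(3)[OF assms(3)]] by blast
  qed
qed

lemma continuous_on_M_t: "continuous_on regular (\<lambda>(x, \<xi>). M_t \<mu>t x \<xi> s)"
proof (rule continuous_on_sequentiallyI)
  fix u a assume u: "\<forall>n. u n \<in> regular" "a \<in> regular" "u \<longlonglongrightarrow> a"
  obtain x \<xi> where a: "a = (x, \<xi>)" by (cases a)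
  have "continuous_on (\<Omega>0 \<times> S1) (\<lambda>z. \<mu>t (fst z))"
    using mu_cont(1) by (intro continuous_on_compose2[OF mu_cont(1)] continuous_intros) auto
  from regular_limit[OF u(3)[unfolded a] _ u(2)[unfolded a] this] u(1) mu_zero
  have *: "AE r in lborel. 0 \<le> r \<longrightarrow>
      (\<lambda>n. \<mu>t (fst (u n) - r *\<^sub>R snd (u n))) \<longlonglongrightarrow> \<mu>t (x - r *\<^sub>R \<xi>)" by simp
  have "(\<lambda>n. M_t \<mu>t (fst (u n)) (snd (u n)) s) \<longlonglongrightarrow> M_t \<mu>t x \<xi> s"
    unfolding M_t_def
  proof (rule set_integral_dominated_convergence)
    show "AE r in lborel. r \<in> {0..s} \<longrightarrow>
      (\<lambda>n. \<mu>t (fst (u n) - r *\<^sub>R snd (u n))) \<longlonglongrightarrow> \<mu>t (x - r *\<^sub>R \<xi>)"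
      using * by eventually_elim auto
    show "\<bar>\<mu>t (fst (u n) - r *\<^sub>R snd (u n))\<bar> \<le> m" for n r
      using absorption.abs_le[OF absorption_line] .
  qed measurable
  thus "(\<lambda>n. case u n of (x, \<xi>) \<Rightarrow> M_t \<mu>t x \<xi> s) \<longlonglongrightarrow> (case a of (x, \<xi>) \<Rightarrow> M_t \<mu>t x \<xi> s)"
    by (simp add: a case_prod_unfold)
qed

text \<open>\<open>H\<close> is controlled on \<open>\<Omega>0 \<times> S1\<close> only; the weight
  removes the rest of the plane.\<close>

lemma measurable_weighted:
  assumes "continuous_on (\<Omega>0 \<times> S1) H" "\<xi> \<in> S1"
  shows "(\<lambda>y. \<mu>s y * H (y, \<xi>)) \<in> borel_measurable borel"
proof (rule borel_measurable_open_support[OF open_Omega0])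
  show "continuous_on \<Omega>0 (\<lambda>y. \<mu>s y * H (y, \<xi>))"
    using assms(2) by (intro continuous_on_mult mu_cont continuous_on_compose2[OF assms(1)] continuous_intros) auto
qed (simp add: mu_zero)

text \<open>The majorant keeps \<open>\<mu>t\<close> together with its own attenuation because that
  product has a known integral. Bounding it by \<open>m\<close> would lead to a factor
  \<open>m * R\<close>, which need not be below 1.\<close>

lemma stream_integrand_le:
  assumes "\<forall>z\<in>\<Omega>0 \<times> S1. \<bar>H z\<bar> \<le> h" "0 \<le> h" "\<xi> \<in> S1"
  shows "\<bar>\<mu>s (x - s *\<^sub>R \<xi>) * exp (- M_t \<mu>t x \<xi> s) * H (x - s *\<^sub>R \<xi>, \<xi>)\<bar>
    \<le> (\<mu>t (x - s *\<^sub>R \<xi>) * exp (- M_t \<mu>t x \<xi> s)) * h"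
proof (cases "x - s *\<^sub>R \<xi> \<in> \<Omega>0")
  case True
  have "0 \<le> \<mu>t (x - s *\<^sub>R \<xi>)" using mu_nonneg mu_le by (rule order_trans)
  moreover have "\<bar>H (x - s *\<^sub>R \<xi>, \<xi>)\<bar> \<le> h" using True assms(1,3) by auto
  moreover have "\<bar>\<mu>s (x - s *\<^sub>R \<xi>)\<bar> \<le> \<mu>t (x - s *\<^sub>R \<xi>)" using mu_nonneg mu_le by simp
  ultimately show ?thesis unfolding abs_mult abs_exp_cancel by (intro mult_mono) auto
next
  case False
  thus ?thesis by (simp add: mu_zero)
qed

lemma stream_integrand_bound:
  assumes "\<forall>z\<in>\<Omega>0 \<times> S1. \<bar>H z\<bar> \<le> h" "0 \<le> h" "\<xi> \<in> S1"
  shows "\<bar>\<mu>s (x - s *\<^sub>R \<xi>) * exp (- M_t \<mu>t x \<xi> s) * H (x - s *\<^sub>R \<xi>, \<xi>)\<bar> \<le> m * h"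
proof -
  have "\<mu>t (x - s *\<^sub>R \<xi>) * exp (- M_t \<mu>t x \<xi> s) \<le> m"
    using absorption.attenuated_bounded[OF absorption_line, folded M_t_depth] by (rule abs_le_D1)
  hence "\<mu>t (x - s *\<^sub>R \<xi>) * exp (- M_t \<mu>t x \<xi> s) * h \<le> m * h"
    using assms(2) by (rule mult_right_mono)
  moreover have "\<bar>\<mu>s (x - s *\<^sub>R \<xi>) * exp (- M_t \<mu>t x \<xi> s) * H (x - s *\<^sub>R \<xi>, \<xi>)\<bar>
    \<le> \<mu>t (x - s *\<^sub>R \<xi>) * exp (- M_t \<mu>t x \<xi> s) * h"
    using assms by (rule stream_integrand_le)
  ultimately show ?thesis by linarith
qed

lemma measurable_stream_integrand:
  assumes "(\<lambda>y. \<mu>s y * H (y, \<xi>)) \<in> borel_measurable borel"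
  shows "(\<lambda>s. \<mu>s (x - s *\<^sub>R \<xi>) * exp (- M_t \<mu>t x \<xi> s) * H (x - s *\<^sub>R \<xi>, \<xi>)) \<in> borel_measurable borel"
proof -
  have "(\<lambda>s. (\<mu>s (x - s *\<^sub>R \<xi>) * H (x - s *\<^sub>R \<xi>, \<xi>)) * exp (- M_t \<mu>t x \<xi> s)) \<in> borel_measurable borel"
    using measurable_compose[OF measurable_line assms, of x \<xi>] by measurable
  thus ?thesis by (simp add: mult_ac)
qed

lemma continuous_on_stream:
  assumes H: "continuous_on (\<Omega>0 \<times> S1) H" "\<forall>z\<in>\<Omega>0 \<times> S1. \<bar>H z\<bar> \<le> h" and "0 \<le> h"
  shows "continuous_on regular (stream H)"
proof (rule continuous_on_sequentiallyI)
  fix u a assume u: "\<forall>n. u n \<in> regular" "a \<in> regular" "u \<longlonglongrightarrow> a"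
  obtain x \<xi> where a: "a = (x, \<xi>)" by (cases a)
  have xi: "\<xi> \<in> S1" using regularD(3) u(2) a by simp
  have S: "snd (u n) \<in> S1" for n using regularD(3)[of "fst (u n)" "snd (u n)"] u(1) by simp
  \<comment> \<open>The attenuation is kept apart: \<open>regular_limit\<close> handles functions of
    the current point and direction, whereas \<open>M_t\<close> depends on the whole ray up to that
    point.\<close>
  have "continuous_on (\<Omega>0 \<times> S1) (\<lambda>z. \<mu>s (fst z) * H z)"
    by (intro continuous_on_mult H continuous_on_compose2[OF mu_cont(2)] continuous_intros) auto
  from regular_limit[OF u(3)[unfolded a] _ u(2)[unfolded a] this] u(1) mu_zero
  have *: "AE s in lborel. 0 \<le> s \<longrightarrow>
      (\<lambda>n. \<mu>s (fst (u n) - s *\<^sub>R snd (u n)) * H (fst (u n) - s *\<^sub>R snd (u n), snd (u n)))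
        \<longlonglongrightarrow> \<mu>s (x - s *\<^sub>R \<xi>) * H (x - s *\<^sub>R \<xi>, \<xi>)" by simp
  have "(\<lambda>n. LINT s:{0..R}|lborel. \<mu>s (fst (u n) - s *\<^sub>R snd (u n)) *
          exp (- M_t \<mu>t (fst (u n)) (snd (u n)) s) * H (fst (u n) - s *\<^sub>R snd (u n), snd (u n)))
        \<longlonglongrightarrow> (LINT s:{0..R}|lborel. \<mu>s (x - s *\<^sub>R \<xi>) * exp (- M_t \<mu>t x \<xi> s) * H (x - s *\<^sub>R \<xi>, \<xi>))"
  proof (rule set_integral_dominated_convergence)
    show "AE s in lborel. s \<in> {0..R} \<longrightarrow>
      (\<lambda>n. \<mu>s (fst (u n) - s *\<^sub>R snd (u n)) * exp (- M_t \<mu>t (fst (u n)) (snd (u n)) s) *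
           H (fst (u n) - s *\<^sub>R snd (u n), snd (u n)))
        \<longlonglongrightarrow> \<mu>s (x - s *\<^sub>R \<xi>) * exp (- M_t \<mu>t x \<xi> s) * H (x - s *\<^sub>R \<xi>, \<xi>)"
      using *
    proof eventually_elim
      case (elim s)
      show ?case
      proof
        assume "s \<in> {0..R}"
        with elim have 1: "(\<lambda>n. \<mu>s (fst (u n) - s *\<^sub>R snd (u n)) * H (fst (u n) - s *\<^sub>R snd (u n), snd (u n)))
          \<longlonglongrightarrow> \<mu>s (x - s *\<^sub>R \<xi>) * H (x - s *\<^sub>R \<xi>, \<xi>)" by simp
        have 2: "(\<lambda>n. M_t \<mu>t (fst (u n)) (snd (u n)) s) \<longlonglongrightarrow> M_t \<mu>t x \<xi> s"
          using continuous_on_tendsto_compose[OF continuous_on_M_t u(3,2)] u(1)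
          by (simp add: a case_prod_unfold)
        show "(\<lambda>n. \<mu>s (fst (u n) - s *\<^sub>R snd (u n)) * exp (- M_t \<mu>t (fst (u n)) (snd (u n)) s) *
           H (fst (u n) - s *\<^sub>R snd (u n), snd (u n)))
          \<longlonglongrightarrow> \<mu>s (x - s *\<^sub>R \<xi>) * exp (- M_t \<mu>t x \<xi> s) * H (x - s *\<^sub>R \<xi>, \<xi>)"
          using tendsto_mult[OF 1 tendsto_exp[OF tendsto_minus[OF 2]]] by (simp add: mult_ac)
      qed
    qed
    show "\<bar>\<mu>s (fst (u n) - s *\<^sub>R snd (u n)) * exp (- M_t \<mu>t (fst (u n)) (snd (u n)) s) *
           H (fst (u n) - s *\<^sub>R snd (u n), snd (u n))\<bar> \<le> m * h" for n s
      using stream_integrand_bound[OF H(2) \<open>0 \<le> h\<close> S] .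
  qed (intro measurable_stream_integrand measurable_weighted[OF H(1)] S xi)+
  thus "(\<lambda>n. stream H (u n)) \<longlonglongrightarrow> stream H a" by (simp add: stream_def a case_prod_unfold)
qed

text \<open>The majorant integrates to \<open>1 - exp (- M_t)\<close> at \<open>R\<close>, and the
  depth there is at most \<open>m * R\<close>. Only measurability of the weighted sources is
  assumed, so that one of them may stem from the solution itself.\<close>

lemma stream_contraction:
  assumes H: "(\<lambda>y. \<mu>s y * H (y, \<xi>)) \<in> borel_measurable borel" "\<forall>z\<in>\<Omega>0 \<times> S1. \<bar>H z\<bar> \<le> h"
    and H': "(\<lambda>y. \<mu>s y * H' (y, \<xi>)) \<in> borel_measurable borel" "\<forall>z\<in>\<Omega>0 \<times> S1. \<bar>H' z\<bar> \<le> h"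
    and close: "\<forall>z\<in>\<Omega>0 \<times> S1. \<bar>H z - H' z\<bar> \<le> e" and "0 \<le> h" "0 \<le> e" "\<xi> \<in> S1"
  shows "\<bar>stream H (x, \<xi>) - stream H' (x, \<xi>)\<bar> \<le> (1 - exp (- (m * R))) * e"
proof -
  let ?w = "\<lambda>s. \<mu>s (x - s *\<^sub>R \<xi>) * exp (- M_t \<mu>t x \<xi> s)"
  let ?g = "\<lambda>s. \<mu>t (x - s *\<^sub>R \<xi>) * exp (- M_t \<mu>t x \<xi> s)"
  have int: "set_integrable lborel {0..R} (\<lambda>s. ?w s * H (x - s *\<^sub>R \<xi>, \<xi>))"
    by (rule set_integrable_bounded[OF measurable_stream_integrand[OF H(1)]
          stream_integrand_bound[OF H(2) \<open>0 \<le> h\<close> \<open>\<xi> \<in> S1\<close>]])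
  have int': "set_integrable lborel {0..R} (\<lambda>s. ?w s * H' (x - s *\<^sub>R \<xi>, \<xi>))"
    by (rule set_integrable_bounded[OF measurable_stream_integrand[OF H'(1)]
          stream_integrand_bound[OF H'(2) \<open>0 \<le> h\<close> \<open>\<xi> \<in> S1\<close>]])
  have intd: "set_integrable lborel {0..R} (\<lambda>s. ?w s * (H (x - s *\<^sub>R \<xi>, \<xi>) - H' (x - s *\<^sub>R \<xi>, \<xi>)))"
    using set_integral_diff(1)[OF int int'] by (simp add: right_diff_distrib)
  have intg: "set_integrable lborel {0..R} (\<lambda>s. ?g s * e)"
  proof (rule set_integrable_mult_left, rule set_integrable_bounded)
    show "\<bar>?g s\<bar> \<le> m" for s
      by (rule absorption.attenuated_bounded[OF absorption_line, folded M_t_depth])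
  qed measurable
  have eq: "stream H (x, \<xi>) - stream H' (x, \<xi>) =
      (LINT s:{0..R}|lborel. ?w s * (H (x - s *\<^sub>R \<xi>, \<xi>) - H' (x - s *\<^sub>R \<xi>, \<xi>)))"
    using set_integral_diff(2)[OF int int'] by (simp add: stream_def right_diff_distrib)
  have "\<bar>stream H (x, \<xi>) - stream H' (x, \<xi>)\<bar>
      \<le> (LINT s:{0..R}|lborel. \<bar>?w s * (H (x - s *\<^sub>R \<xi>, \<xi>) - H' (x - s *\<^sub>R \<xi>, \<xi>))\<bar>)"
    using set_integral_norm_bound[OF intd] unfolding eq real_norm_def .
  also have "\<dots> \<le> (LINT s:{0..R}|lborel. ?g s * e)"
  proof (rule set_integral_mono[OF _ intg])
    show "set_integrable lborel {0..R} (\<lambda>s. \<bar>?w s * (H (x - s *\<^sub>R \<xi>, \<xi>) - H' (x - s *\<^sub>R \<xi>, \<xi>))\<bar>)"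
      by (rule set_integrable_abs[OF intd])
    show "\<bar>?w s * (H (x - s *\<^sub>R \<xi>, \<xi>) - H' (x - s *\<^sub>R \<xi>, \<xi>))\<bar> \<le> ?g s * e" for s
      by (rule stream_integrand_le[of "\<lambda>z. H z - H' z", OF close \<open>0 \<le> e\<close> \<open>\<xi> \<in> S1\<close>])
  qed
  also have "\<dots> = (1 - exp (- M_t \<mu>t x \<xi> R)) * e"
    using integral_attenuated[OF R_nonneg, of x \<xi>] by simp
  also have "\<dots> \<le> (1 - exp (- (m * R))) * e"
    using M_t_le[OF R_nonneg] \<open>0 \<le> e\<close> by (intro mult_right_mono) auto
  finally show ?thesis .
qed

end

subsection \<open>Continuity of the scattered radiation\<close>

context transport_medium
begin

text \<open>The finite exceptional set may depend on the point: it contains \<open>E\<close> and the directions in which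
  the backward ray from the point hits \<open>\<gamma>\<close>.\<close>

definition almost_continuous :: "((real^2) \<times> (real^2) \<Rightarrow> real) \<Rightarrow> bool" where
  "almost_continuous f \<longleftrightarrow> (\<exists>b. \<forall>z\<in>\<Omega> \<times> S1. \<bar>f z\<bar> \<le> b) \<and>
     (\<forall>y\<in>\<Omega>. \<exists>N. finite N \<and> (\<forall>\<xi>\<in>S1 - N. continuous (at (y, \<xi>) within \<Omega> \<times> S1) f))"

text \<open>Discontinuities are measured in the whole phase space. Since \<open>E\<close> is finite,
  \<open>regular\<close> is relatively open there, and continuity shown within it carries
  over.\<close>

lemma at_regular:
  assumes "(x, \<xi>) \<in> regular"
  shows "at (x, \<xi>) within phase_D_bar \<Omega> = at (x, \<xi>) within regular"
proof (rule at_within_nhd)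
  show "(x, \<xi>) \<in> UNIV \<times> (- E)" using assms by (auto simp: regular_def)
  show "open ((UNIV :: (real^2) set) \<times> (- E))"
    using finite_imp_closed[OF finite_E] by (intro open_Times open_Compl) auto
qed (auto simp: regular_def)

lemma Omega_S1_subset: "\<Omega> \<times> S1 \<subseteq> phase_D_bar \<Omega>"
  using interior_phase_D phase_D_subset by auto

lemma measurable_section:
  assumes "almost_continuous f" "y \<in> \<Omega>"
  shows "(\<lambda>\<xi>. f (y, \<xi>)) \<in> borel_measurable circle_measure"
proof -
  obtain N where N: "finite N" "\<forall>\<xi>\<in>S1 - N. continuous (at (y, \<xi>) within \<Omega> \<times> S1) f"
    using assms unfolding almost_continuous_def by blast
  have "continuous_on (S1 - N) (\<lambda>\<xi>. f (y, \<xi>))"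
    unfolding continuous_on_eq_continuous_within
  proof
    fix \<xi> assume \<xi>: "\<xi> \<in> S1 - N"
    have "continuous (at (y, \<xi>) within (\<lambda>\<xi>. (y, \<xi>)) ` (S1 - N)) f"
    proof (rule continuous_within_subset)
      show "continuous (at (y, \<xi>) within \<Omega> \<times> S1) f" using N(2) \<xi> by blast
      show "(\<lambda>\<xi>. (y, \<xi>)) ` (S1 - N) \<subseteq> \<Omega> \<times> S1" using assms(2) by blast
    qed
    moreover have "continuous (at \<xi> within S1 - N) (\<lambda>\<xi>. (y, \<xi>))"
      by (intro continuous_Pair continuous_const continuous_ident)
    ultimately show "continuous (at \<xi> within S1 - N) (\<lambda>\<xi>. f (y, \<xi>))"
      by (rule continuous_within_compose2[rotated])
  qed
  thus ?thesis by (rule borel_measurable_circle[OF N(1)])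
qed

lemma measurable_p:
  assumes "y \<in> \<Omega>0" "\<xi> \<in> S1"
  shows "p y \<xi> \<in> borel_measurable circle_measure"
proof -
  have "continuous_on S1 (\<lambda>\<xi>'. (\<lambda>(x, \<xi>, \<xi>'). p x \<xi> \<xi>') (y, \<xi>, \<xi>'))"
    using assms by (intro continuous_on_compose2[OF p_cont] continuous_intros) auto
  thus ?thesis by (intro borel_measurable_circle[of "{}"]) auto
qed

lemma integrable_p_mult:
  assumes "y \<in> \<Omega>0" "\<xi> \<in> S1" "h \<in> borel_measurable circle_measure" "\<forall>\<xi>'\<in>S1. \<bar>h \<xi>'\<bar> \<le> b"
  shows "integrable circle_measure (\<lambda>\<xi>'. p y \<xi> \<xi>' * h \<xi>')"
proof (rule circle_measure.integrable_const_bound)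
  have "\<bar>p y \<xi> \<xi>'\<bar> * \<bar>h \<xi>'\<bar> \<le> pb * b" if "\<xi>' \<in> S1" for \<xi>'
    using p_nonneg[OF assms(2) that] p_le[OF assms(2) that] assms(4) that
    by (intro mult_mono) (auto intro: order_trans)
  thus "AE \<xi>' in circle_measure. norm (p y \<xi> \<xi>' * h \<xi>') \<le> pb * b"
    by (intro AE_I2) (simp add: abs_mult)
qed (use measurable_p[OF assms(1,2)] assms(3) in measurable)

text \<open>\<open>p y \<xi>\<close> is a probability density on the circle, so a uniform error
  passes through with constant 1. This preserves the contraction factor of
  \<open>stream\<close>.\<close>

lemma scatter_diff_le:
  assumes y: "y \<in> \<Omega>0" "\<xi> \<in> S1"
    and f: "(\<lambda>\<xi>. f (y, \<xi>)) \<in> borel_measurable circle_measure" "\<forall>\<xi>\<in>S1. \<bar>f (y, \<xi>)\<bar> \<le> b"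
    and f': "(\<lambda>\<xi>. f' (y, \<xi>)) \<in> borel_measurable circle_measure" "\<forall>\<xi>\<in>S1. \<bar>f' (y, \<xi>)\<bar> \<le> b'"
    and close: "\<forall>\<xi>\<in>S1. \<bar>f (y, \<xi>) - f' (y, \<xi>)\<bar> \<le> e"
  shows "\<bar>scatter f (y, \<xi>) - scatter f' (y, \<xi>)\<bar> \<le> e"
proof -
  note int = integrable_p_mult[OF y f] and int' = integrable_p_mult[OF y f']
  have ie: "integrable circle_measure (\<lambda>\<xi>'. p y \<xi> \<xi>' * e)"
    by (rule integrable_p_mult[OF y, of _ "\<bar>e\<bar>"]) auto
  have eq: "scatter f (y, \<xi>) - scatter f' (y, \<xi>) =
      (LINT \<xi>'|circle_measure. p y \<xi> \<xi>' * (f (y, \<xi>') - f' (y, \<xi>')))"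
    using Bochner_Integration.integral_diff[OF int int'] by (simp add: scatter_def right_diff_distrib)
  have "\<bar>scatter f (y, \<xi>) - scatter f' (y, \<xi>)\<bar> \<le> (LINT \<xi>'|circle_measure. p y \<xi> \<xi>' * e)"
    unfolding eq
  proof (rule integral_abs_bound_integral[OF _ ie])
    show "integrable circle_measure (\<lambda>\<xi>'. p y \<xi> \<xi>' * (f (y, \<xi>') - f' (y, \<xi>')))"
      using Bochner_Integration.integrable_diff[OF int int'] by (simp add: right_diff_distrib)
    show "\<bar>p y \<xi> \<xi>' * (f (y, \<xi>') - f' (y, \<xi>'))\<bar> \<le> p y \<xi> \<xi>' * e" if "\<xi>' \<in> space circle_measure" for \<xi>'
      using p_nonneg[OF y(2)] close that by (auto simp: abs_mult intro!: mult_left_mono)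
  qed
  also have "\<dots> = e" using p_total[OF y] by simp
  finally show ?thesis .
qed

lemma scatter_le:
  assumes y: "y \<in> \<Omega>0" "\<xi> \<in> S1"
    and f: "(\<lambda>\<xi>. f (y, \<xi>)) \<in> borel_measurable circle_measure" "\<forall>\<xi>\<in>S1. \<bar>f (y, \<xi>)\<bar> \<le> b"
  shows "\<bar>scatter f (y, \<xi>)\<bar> \<le> b"
  using scatter_diff_le[OF y f, of "\<lambda>_. 0" 0 b] f(2) by (simp add: scatter_def)

text \<open>Continuity of \<open>f\<close> is used only at the limit point \<open>y\<close>, in
  directions outside its own finite set \<open>N\<close>, which is null. At the approximating points
  measurable sections suffice, so dominated convergence applies although the exceptional sets move
  with the point.\<close>

lemma continuous_on_scatter:
  assumes f: "almost_continuous f"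
  shows "continuous_on (\<Omega>0 \<times> S1) (scatter f)"
proof (rule continuous_on_sequentiallyI)
  fix u a assume u: "\<forall>n. u n \<in> \<Omega>0 \<times> S1" "a \<in> \<Omega>0 \<times> S1" "u \<longlonglongrightarrow> a"
  obtain y \<xi> where a: "a = (y, \<xi>)" by (cases a)
  have y: "y \<in> \<Omega>0" "\<xi> \<in> S1" using u(2) a by auto
  have un: "fst (u n) \<in> \<Omega>0" "snd (u n) \<in> S1" for n using u(1)[rule_format, of n] by (auto simp: mem_Times_iff)
  have lim: "(\<lambda>n. fst (u n)) \<longlonglongrightarrow> y" "(\<lambda>n. snd (u n)) \<longlonglongrightarrow> \<xi>"
    using tendsto_fst[OF u(3)] tendsto_snd[OF u(3)] by (auto simp: a)
  obtain b where b: "\<forall>z\<in>\<Omega> \<times> S1. \<bar>f z\<bar> \<le> b" using f unfolding almost_continuous_def by blast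
  obtain N where N: "finite N" "\<forall>\<eta>\<in>S1 - N. continuous (at (y, \<eta>) within \<Omega> \<times> S1) f"
    using f y Omega0_subset unfolding almost_continuous_def by blast
  have "(\<lambda>n. LINT \<eta>|circle_measure. p (fst (u n)) (snd (u n)) \<eta> * f (fst (u n), \<eta>))
      \<longlonglongrightarrow> (LINT \<eta>|circle_measure. p y \<xi> \<eta> * f (y, \<eta>))"
  proof (rule integral_dominated_convergence)
    show "(\<lambda>\<eta>. p y \<xi> \<eta> * f (y, \<eta>)) \<in> borel_measurable circle_measure"
      using y Omega0_subset by (intro borel_measurable_times measurable_p measurable_section[OF f]) auto
    show "(\<lambda>\<eta>. p (fst (u n)) (snd (u n)) \<eta> * f (fst (u n), \<eta>)) \<in> borel_measurable circle_measure" for n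
      using un[of n] Omega0_subset
      by (intro borel_measurable_times measurable_p measurable_section[OF f]) auto
    show "integrable circle_measure (\<lambda>\<eta>. pb * b)" by simp
    have "\<bar>p (fst (u n)) (snd (u n)) \<eta>\<bar> * \<bar>f (fst (u n), \<eta>)\<bar> \<le> pb * b" if "\<eta> \<in> S1" for n \<eta>
    proof (rule mult_mono)
      show "\<bar>p (fst (u n)) (snd (u n)) \<eta>\<bar> \<le> pb"
        using p_nonneg[OF un(2) that] p_le[OF un(2) that] by simp
      thus "0 \<le> pb" by linarith
      show "\<bar>f (fst (u n), \<eta>)\<bar> \<le> b" using b un(1)[of n] Omega0_subset that by auto
    qed simp
    thus "AE \<eta> in circle_measure. norm (p (fst (u n)) (snd (u n)) \<eta> * f (fst (u n), \<eta>)) \<le> pb * b" for n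
      by (intro AE_I2) (simp add: abs_mult)
    have "(\<lambda>n. p (fst (u n)) (snd (u n)) \<eta> * f (fst (u n), \<eta>)) \<longlonglongrightarrow> p y \<xi> \<eta> * f (y, \<eta>)"
      if eta: "\<eta> \<in> S1" "\<eta> \<notin> N" for \<eta>
    proof (rule tendsto_mult)
      have "(\<lambda>n. (\<lambda>(x, \<xi>, \<xi>'). p x \<xi> \<xi>') (fst (u n), snd (u n), \<eta>)) \<longlonglongrightarrow> (\<lambda>(x, \<xi>, \<xi>'). p x \<xi> \<xi>') (y, \<xi>, \<eta>)"
      proof (rule continuous_on_tendsto_compose[OF p_cont])
        show "(\<lambda>n. (fst (u n), snd (u n), \<eta>)) \<longlonglongrightarrow> (y, \<xi>, \<eta>)"
          by (intro tendsto_Pair lim tendsto_const)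
        show "(y, \<xi>, \<eta>) \<in> \<Omega>0 \<times> S1 \<times> S1" using y eta(1) by simp
        show "\<forall>\<^sub>F n in sequentially. (fst (u n), snd (u n), \<eta>) \<in> \<Omega>0 \<times> S1 \<times> S1"
          using un eta(1) by simp
      qed
      thus "(\<lambda>n. p (fst (u n)) (snd (u n)) \<eta>) \<longlonglongrightarrow> p y \<xi> \<eta>" by simp
      show "(\<lambda>n. f (fst (u n), \<eta>)) \<longlonglongrightarrow> f (y, \<eta>)"
      proof (rule continuous_within_tendsto_compose'
            [where f = f and x = "\<lambda>n. (fst (u n), \<eta>)"])
        show "continuous (at (y, \<eta>) within \<Omega> \<times> S1) f" using N(2) eta by blast
        show "(fst (u n), \<eta>) \<in> \<Omega> \<times> S1" for n using un(1)[of n] Omega0_subset eta(1) by auto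
        show "(\<lambda>n. (fst (u n), \<eta>)) \<longlonglongrightarrow> (y, \<eta>)" by (intro tendsto_Pair lim tendsto_const)
      qed
    qed
    moreover have "AE \<eta> in circle_measure. \<eta> \<in> S1" by (intro AE_I2) simp
    ultimately show "AE \<eta> in circle_measure.
        (\<lambda>n. p (fst (u n)) (snd (u n)) \<eta> * f (fst (u n), \<eta>)) \<longlonglongrightarrow> p y \<xi> \<eta> * f (y, \<eta>)"
      using AE_circle_measure_finite[OF N(1)] by (auto elim: AE_mp)
  qed
  thus "(\<lambda>n. scatter f (u n)) \<longlonglongrightarrow> scatter f a" by (simp add: scatter_def a case_prod_unfold)
qed

section \<open>The scattering integral of the solution as a uniform limit\<close>

lemma measurable_solution_section:
  assumes I: "I \<in> borel_measurable (restrict_space borel (phase_D \<Omega>))" and y: "y \<in> \<Omega>"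
  shows "(\<lambda>\<xi>. I (y, \<xi>)) \<in> borel_measurable circle_measure"
proof -
  have "Pair y \<in> restrict_space borel S1 \<rightarrow>\<^sub>M restrict_space borel (phase_D \<Omega>)"
  proof (rule measurable_restrict_space2)
    show "Pair y \<in> space (restrict_space borel S1) \<rightarrow> phase_D \<Omega>"
      using interior_phase_D[OF y] by (auto simp: space_restrict_space)
    show "Pair y \<in> borel_measurable (restrict_space borel S1)"
      by (intro borel_measurable_continuous_on_restrict continuous_intros)
  qed
  hence "Pair y \<in> circle_measure \<rightarrow>\<^sub>M restrict_space borel (phase_D \<Omega>)"
    by (simp add: measurable_cong_sets[OF sets_circle_measure refl])
  from measurable_compose[OF this I] show ?thesis .
qed

text \<open>Measurability in the base point of an integral over directions, by the product measure.
  \<open>I\<close> is measurable on \<open>phase_D \<Omega>\<close> only, so the integrand is first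
  extended by zero from \<open>\<Omega>0 \<times> S1\<close>.\<close>

lemma measurable_weighted_scatter:
  assumes I: "I \<in> borel_measurable (restrict_space borel (phase_D \<Omega>))" and xi: "\<xi> \<in> S1"
  shows "(\<lambda>y. \<mu>s y * scatter I (y, \<xi>)) \<in> borel_measurable borel"
proof -
  let ?W = "\<Omega>0 \<times> S1"
  let ?h = "\<lambda>z. p (fst z) \<xi> (snd z) * I z"
  have W: "?W \<in> sets borel" by (intro borel_Times borel_open borel_closed open_Omega0) simp
  have "?W \<subseteq> phase_D \<Omega>" using Omega0_subset interior_phase_D by blast
  hence "I \<in> borel_measurable (restrict_space borel ?W)"
    using measurable_restrict_mono[OF I] by blast
  moreover have "(\<lambda>z. p (fst z) \<xi> (snd z)) \<in> borel_measurable (restrict_space borel ?W)"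
  proof (rule borel_measurable_continuous_on_restrict)
    have "continuous_on ?W (\<lambda>z. (\<lambda>(x, \<xi>, \<xi>'). p x \<xi> \<xi>') (fst z, \<xi>, snd z))"
      using xi by (intro continuous_on_compose2[OF p_cont] continuous_intros) auto
    thus "continuous_on ?W (\<lambda>z. p (fst z) \<xi> (snd z))" by simp
  qed
  ultimately have "?h \<in> borel_measurable (restrict_space borel ?W)"
    by (intro borel_measurable_times)
  hence g: "(\<lambda>z. indicator ?W z *\<^sub>R ?h z) \<in> borel_measurable borel"
    using W by (subst (asm) borel_measurable_restrict_space_iff) auto
  have "(\<lambda>\<eta>. \<eta>) \<in> borel_measurable circle_measure"
    unfolding measurable_cong_sets[OF sets_circle_measure refl]
    by (intro borel_measurable_continuous_on_restrict continuous_intros)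
  \<comment> \<open>This identity map changes the measurable space: the circle measure lives on the
    circle, the extended integrand on the whole plane in both variables.\<close>
  hence "(\<lambda>z. (fst z, snd z)) \<in> borel \<Otimes>\<^sub>M circle_measure \<rightarrow>\<^sub>M (borel :: ((real^2) \<times> (real^2)) measure)"
    unfolding borel_prod[symmetric]
    by (intro measurable_Pair measurable_fst measurable_compose[OF measurable_snd])
  from measurable_compose[OF this g]
  have "(\<lambda>(y, \<eta>). indicator ?W (y, \<eta>) *\<^sub>R ?h (y, \<eta>)) \<in> borel_measurable (borel \<Otimes>\<^sub>M circle_measure)"
    by (simp add: case_prod_unfold)
  from circle_measure.borel_measurable_lebesgue_integral[OF this]
  have "(\<lambda>y. LINT \<eta>|circle_measure. indicator ?W (y, \<eta>) *\<^sub>R ?h (y, \<eta>)) \<in> borel_measurable borel" .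
  hence "(\<lambda>y. \<mu>s y * (LINT \<eta>|circle_measure. indicator ?W (y, \<eta>) *\<^sub>R ?h (y, \<eta>))) \<in> borel_measurable borel"
    by measurable
  moreover have "\<mu>s y * (LINT \<eta>|circle_measure. indicator ?W (y, \<eta>) *\<^sub>R ?h (y, \<eta>)) = \<mu>s y * scatter I (y, \<xi>)" for y
  proof (cases "y \<in> \<Omega>0")
    case True
    hence "(LINT \<eta>|circle_measure. indicator ?W (y, \<eta>) *\<^sub>R ?h (y, \<eta>)) = scatter I (y, \<xi>)"
      unfolding scatter_def prod.case by (intro Bochner_Integration.integral_cong) auto
    thus ?thesis by simp
  qed (simp add: mu_zero)
  ultimately show ?thesis by (simp only:)
qed

lemma stream_le:
  assumes "(\<lambda>y. \<mu>s y * H (y, \<xi>)) \<in> borel_measurable borel" "\<forall>z\<in>\<Omega>0 \<times> S1. \<bar>H z\<bar> \<le> h" "0 \<le> h" "\<xi> \<in> S1"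
  shows "\<bar>stream H (x, \<xi>)\<bar> \<le> h"
proof -
  have "\<bar>stream H (x, \<xi>) - stream (\<lambda>_. 0) (x, \<xi>)\<bar> \<le> (1 - exp (- (m * R))) * h"
    using assms by (intro stream_contraction[where h = h]) auto
  also have "\<dots> \<le> 1 * h" using assms(3) by (intro mult_right_mono) auto
  finally show ?thesis by (simp add: stream_def)
qed

text \<open>The exceptional directions of \<open>f\<close> disappear in the scattering integral;
  only those of \<open>b\<close> and the set \<open>E\<close> remain, so they do not accumulate
  along the iteration.\<close>

lemma almost_continuous_iterate:
  assumes b: "almost_continuous b" and f: "almost_continuous f"
  shows "almost_continuous (\<lambda>z. b z + stream (scatter f) z)"
proof -
  obtain c where c: "\<forall>z\<in>\<Omega> \<times> S1. \<bar>f z\<bar> \<le> c" using f unfolding almost_continuous_def by blast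
  obtain d where d: "\<forall>z\<in>\<Omega> \<times> S1. \<bar>b z\<bar> \<le> d" using b unfolding almost_continuous_def by blast
  have sc: "\<forall>z\<in>\<Omega>0 \<times> S1. \<bar>scatter f z\<bar> \<le> \<bar>c\<bar>"
  proof
    fix z assume z: "z \<in> \<Omega>0 \<times> S1"
    have zz: "fst z \<in> \<Omega>0" "snd z \<in> S1" "fst z \<in> \<Omega>" using z Omega0_subset by auto
    have "\<forall>\<eta>\<in>S1. \<bar>f (fst z, \<eta>)\<bar> \<le> \<bar>c\<bar>"
      using c zz(3) abs_ge_self[of c] by (blast intro: order_trans)
    hence "\<bar>scatter f (fst z, snd z)\<bar> \<le> \<bar>c\<bar>"
      by (rule scatter_le[OF zz(1,2) measurable_section[OF f zz(3)]])
    thus "\<bar>scatter f z\<bar> \<le> \<bar>c\<bar>" by simp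
  qed
  note cont = continuous_on_scatter[OF f]
  have "\<bar>b z + stream (scatter f) z\<bar> \<le> d + \<bar>c\<bar>" if z: "z \<in> \<Omega> \<times> S1" for z
  proof -
    have "\<bar>stream (scatter f) (fst z, snd z)\<bar> \<le> \<bar>c\<bar>"
      using z by (intro stream_le measurable_weighted[OF cont] sc) auto
    moreover have "\<bar>b z\<bar> \<le> d" using d z by blast
    ultimately show ?thesis by simp
  qed
  moreover have "\<exists>N. finite N \<and> (\<forall>\<xi>\<in>S1 - N. continuous (at (y, \<xi>) within \<Omega> \<times> S1) (\<lambda>z. b z + stream (scatter f) z))"
    if y: "y \<in> \<Omega>" for y
  proof -
    obtain N where N: "finite N" "\<forall>\<eta>\<in>S1 - N. continuous (at (y, \<eta>) within \<Omega> \<times> S1) b"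
      using b y unfolding almost_continuous_def by blast
    have "continuous (at (y, \<xi>) within \<Omega> \<times> S1) (\<lambda>z. b z + stream (scatter f) z)"
      if xi: "\<xi> \<in> S1 - (N \<union> E)" for \<xi>
    proof (rule continuous_add)
      show "continuous (at (y, \<xi>) within \<Omega> \<times> S1) b" using N(2) xi by blast
      have reg: "(y, \<xi>) \<in> regular" using xi y Omega_S1_subset by (auto simp: regular_def)
      hence "continuous (at (y, \<xi>) within regular) (stream (scatter f))"
        using continuous_on_stream[OF cont sc] by (simp add: continuous_on_eq_continuous_within)
      hence "continuous (at (y, \<xi>) within phase_D_bar \<Omega>) (stream (scatter f))"
        unfolding at_regular[OF reg] .
      thus "continuous (at (y, \<xi>) within \<Omega> \<times> S1) (stream (scatter f))"
        using Omega_S1_subset by (rule continuous_within_subset)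
    qed
    thus ?thesis using N(1) finite_E by (intro exI[of _ "N \<union> E"]) auto
  qed
  ultimately show ?thesis unfolding almost_continuous_def by blast
qed

text \<open>\<open>I\<close> and the iterates obey the same affine recursion, so their distance
  shrinks by the factor \<open>q\<close> in each step. Since \<open>scatter\<close> does not enlarge
  it, \<open>scatter I\<close> is a uniform limit of continuous functions, with nothing but
  boundedness and measurability assumed of \<open>I\<close>.\<close>

lemma continuous_on_scatter_solution:
  assumes b: "almost_continuous b"
    and eq: "\<forall>z\<in>\<Omega> \<times> S1. I z = b z + stream (scatter I) z"
    and I: "I \<in> borel_measurable (restrict_space borel (phase_D \<Omega>))" "\<forall>z\<in>\<Omega> \<times> S1. \<bar>I z\<bar> \<le> c"
  shows "continuous_on (\<Omega>0 \<times> S1) (scatter I)" "\<forall>z\<in>\<Omega>0 \<times> S1. \<bar>scatter I z\<bar> \<le> \<bar>c\<bar>"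
proof -
  define f where "f n = ((\<lambda>f z. b z + stream (scatter f) z) ^^ n) (\<lambda>_. 0)" for n
  define q where "q = 1 - exp (- (m * R))"
  have q: "0 \<le> q" "q < 1" using m_nonneg R_nonneg by (auto simp: q_def)
  have f_Suc: "f (Suc n) = (\<lambda>z. b z + stream (scatter (f n)) z)" for n by (simp add: f_def)
  have ac: "almost_continuous (f n)" for n
  proof (induction n)
    case 0
    show ?case by (auto simp: f_def almost_continuous_def intro!: exI[of _ 0] exI[of _ "{}"])
  next
    case (Suc n)
    thus ?case unfolding f_Suc by (rule almost_continuous_iterate[OF b])
  qed
  have Isec: "(\<lambda>\<xi>. I (y, \<xi>)) \<in> borel_measurable circle_measure" "\<forall>\<xi>\<in>S1. \<bar>I (y, \<xi>)\<bar> \<le> \<bar>c\<bar>"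
    if "y \<in> \<Omega>0" for y
  proof -
    have y: "y \<in> \<Omega>" using that Omega0_subset by blast
    show "(\<lambda>\<xi>. I (y, \<xi>)) \<in> borel_measurable circle_measure"
      by (rule measurable_solution_section[OF I(1) y])
    show "\<forall>\<xi>\<in>S1. \<bar>I (y, \<xi>)\<bar> \<le> \<bar>c\<bar>"
      using I(2) y abs_ge_self[of c] by (blast intro: order_trans)
  qed
  show sI: "\<forall>z\<in>\<Omega>0 \<times> S1. \<bar>scatter I z\<bar> \<le> \<bar>c\<bar>"
  proof
    fix z assume z: "z \<in> \<Omega>0 \<times> S1"
    have zz: "fst z \<in> \<Omega>0" "snd z \<in> S1" using z by auto
    have "\<bar>scatter I (fst z, snd z)\<bar> \<le> \<bar>c\<bar>" by (rule scatter_le[OF zz Isec[OF zz(1)]])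
    thus "\<bar>scatter I z\<bar> \<le> \<bar>c\<bar>" by simp
  qed
  have scat: "\<forall>z\<in>\<Omega>0 \<times> S1. \<bar>scatter (f n) z - scatter I z\<bar> \<le> e"
    if e: "\<forall>z\<in>\<Omega> \<times> S1. \<bar>f n z - I z\<bar> \<le> e" for n e
  proof
    fix z assume z: "z \<in> \<Omega>0 \<times> S1"
    obtain k where k: "\<forall>z\<in>\<Omega> \<times> S1. \<bar>f n z\<bar> \<le> k" using ac[of n] unfolding almost_continuous_def by blast
    have zz: "fst z \<in> \<Omega>0" "snd z \<in> S1" "fst z \<in> \<Omega>" using z Omega0_subset by auto
    have "\<bar>scatter (f n) (fst z, snd z) - scatter I (fst z, snd z)\<bar> \<le> e"
    proof (rule scatter_diff_le[OF zz(1,2) measurable_section[OF ac zz(3)] _ Isec[OF zz(1)]])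
      show "\<forall>\<eta>\<in>S1. \<bar>f n (fst z, \<eta>)\<bar> \<le> k" "\<forall>\<eta>\<in>S1. \<bar>f n (fst z, \<eta>) - I (fst z, \<eta>)\<bar> \<le> e"
        using k e zz(3) by blast+
    qed
    thus "\<bar>scatter (f n) z - scatter I z\<bar> \<le> e" by simp
  qed
  have close: "\<forall>z\<in>\<Omega> \<times> S1. \<bar>f n z - I z\<bar> \<le> q ^ n * \<bar>c\<bar>" for n
  proof (induction n)
    case 0
    have "\<bar>I z\<bar> \<le> \<bar>c\<bar>" if "z \<in> \<Omega> \<times> S1" for z
      using bspec[OF I(2) that] by simp
    thus ?case by (simp add: f_def)
  next
    case (Suc n)
    let ?e = "q ^ n * \<bar>c\<bar>"
    have e: "0 \<le> ?e" using q by simp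
    note sc = scat[OF Suc]
    \<comment> \<open>\<open>stream_contraction\<close> takes one common bound for both sources; the
      bound for \<open>scatter I\<close> plus the current error serves both.\<close>
    have "\<forall>z\<in>\<Omega>0 \<times> S1. \<bar>scatter (f n) z\<bar> \<le> \<bar>c\<bar> + ?e"
    proof
      fix z assume "z \<in> \<Omega>0 \<times> S1"
      thus "\<bar>scatter (f n) z\<bar> \<le> \<bar>c\<bar> + ?e" using bspec[OF sc, of z] bspec[OF sI, of z] by linarith
    qed
    moreover have "\<forall>z\<in>\<Omega>0 \<times> S1. \<bar>scatter I z\<bar> \<le> \<bar>c\<bar> + ?e"
      using sI e by (metis add_increasing2)
    ultimately
    have st: "\<bar>stream (scatter (f n)) (x, \<xi>) - stream (scatter I) (x, \<xi>)\<bar> \<le> q * ?e"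
      if "\<xi> \<in> S1" for x \<xi>
      unfolding q_def
      by (rule stream_contraction[OF measurable_weighted[OF continuous_on_scatter[OF ac] that] _
            measurable_weighted_scatter[OF I(1) that] _ sc[unfolded q_def] _ e[unfolded q_def] that])
         (use e in \<open>auto simp: q_def\<close>)
    show ?case
    proof
      fix z assume z: "z \<in> \<Omega> \<times> S1"
      have "f (Suc n) z - I z = stream (scatter (f n)) (fst z, snd z) - stream (scatter I) (fst z, snd z)"
        using bspec[OF eq z] by (simp add: f_Suc)
      thus "\<bar>f (Suc n) z - I z\<bar> \<le> q ^ Suc n * \<bar>c\<bar>" using st[of "snd z" "fst z"] z by (auto simp: mult.assoc)
    qed
  qed
  have "uniform_limit (\<Omega>0 \<times> S1) (\<lambda>n. scatter (f n)) (scatter I) sequentially"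
  proof (rule uniform_limitI)
    fix e :: real assume e: "e > 0"
    have "(\<lambda>n. q ^ n * \<bar>c\<bar>) \<longlonglongrightarrow> 0 * \<bar>c\<bar>"
      using q by (intro tendsto_mult tendsto_const LIMSEQ_realpow_zero)
    hence "\<forall>\<^sub>F n in sequentially. q ^ n * \<bar>c\<bar> < e" using e order_tendstoD(2) by fastforce
    thus "\<forall>\<^sub>F n in sequentially. \<forall>z\<in>\<Omega>0 \<times> S1. dist (scatter (f n) z) (scatter I z) < e"
    proof eventually_elim
      case (elim n)
      show ?case
      proof
        fix z assume "z \<in> \<Omega>0 \<times> S1"
        from bspec[OF scat[OF close] this, of n] elim
        show "dist (scatter (f n) z) (scatter I z) < e" by (simp add: dist_real_def)
      qed
    qed
  qed
  thus "continuous_on (\<Omega>0 \<times> S1) (scatter I)"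
    by (rule uniform_limit_theorem[rotated]) (auto intro: always_eventually continuous_on_scatter ac)
qed

end

subsection \<open>The jump\<close>

locale transport_problem =
  transport_medium \<Omega> \<Omega>0 E \<mu>t \<mu>s p m pb R + cut_boundary \<Omega> \<gamma> A B C I0
  for \<Omega> \<Omega>0 E \<mu>t \<mu>s p m pb R \<gamma> A B C I0 +
  fixes I :: "(real^2) \<times> (real^2) \<Rightarrow> real"
  assumes solution: "transport_solution \<Omega> \<mu>t \<mu>s p I0 I"
begin

text \<open>The radiation that arrives unscattered. By \<open>M_t_tau_minus\<close> the depth at
  \<open>R\<close> is that at the exit time.\<close>

definition ballistic :: "(real^2) \<times> (real^2) \<Rightarrow> real" where
  "ballistic = (\<lambda>(x, \<xi>). exp (- M_t \<mu>t x \<xi> R) * I0 (P_in \<Omega> x \<xi>, \<xi>))"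

lemma solution_eq:
  assumes D: "(x, \<xi>) \<in> phase_D \<Omega>"
  shows "I (x, \<xi>) = ballistic (x, \<xi>) + stream (scatter I) (x, \<xi>)"
proof -
  have D': "(x, \<xi>) \<in> phase_D_bar \<Omega>" using D phase_D_subset by blast
  have "I (x, \<xi>) =
      exp (- M_t \<mu>t x \<xi> (tau_minus \<Omega> x \<xi>)) * I0 (P_in \<Omega> x \<xi>, \<xi>) +
      (LINT s:{0..tau_minus \<Omega> x \<xi>}|lborel.
         \<mu>s (x - s *\<^sub>R \<xi>) * exp (- M_t \<mu>t x \<xi> s) * scatter I (x - s *\<^sub>R \<xi>, \<xi>))"
    using solution D unfolding transport_solution_def scatter_def by auto
  thus ?thesis by (simp only: stream_tau_minus[OF D'] M_t_tau_minus[OF D'] ballistic_def prod.case)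
qed

lemma incoming_data:
  assumes D: "(x, \<xi>) \<in> phase_D_bar \<Omega>"
  shows "P_in \<Omega> x \<xi> \<in> A \<union> \<gamma> \<Longrightarrow> I0 (P_in \<Omega> x \<xi>, \<xi>) = C"
    and "P_in \<Omega> x \<xi> \<in> B \<Longrightarrow> I0 (P_in \<Omega> x \<xi>, \<xi>) = 0"
  using bspec[OF data(1) P_in_Gamma_minus[OF D]] bspec[OF data(2) P_in_Gamma_minus[OF D]] by auto

lemma ballistic_continuous:
  assumes reg: "(x, \<xi>) \<in> regular" and P: "P_in \<Omega> x \<xi> \<notin> \<gamma>"
  shows "continuous (at (x, \<xi>) within phase_D_bar \<Omega>) ballistic"
proof -
  have "continuous (at (x, \<xi>) within regular) (\<lambda>(x, \<xi>). M_t \<mu>t x \<xi> R)"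
    using continuous_on_M_t reg by (simp add: continuous_on_eq_continuous_within)
  hence "continuous (at (x, \<xi>) within phase_D_bar \<Omega>) (\<lambda>z. exp (- (\<lambda>(x, \<xi>). M_t \<mu>t x \<xi> R) z))"
    unfolding at_regular[OF reg] by (intro continuous_exp continuous_minus)
  from continuous_mult[OF this data_locally_constant[OF regularD(1)[OF reg] P]]
  show ?thesis by (simp add: ballistic_def case_prod_unfold)
qed

lemma almost_continuous_ballistic: "almost_continuous ballistic"
  unfolding almost_continuous_def
proof (intro conjI ballI)
  have "\<bar>ballistic (x, \<xi>)\<bar> \<le> \<bar>C\<bar>" if "x \<in> \<Omega>" "\<xi> \<in> S1" for x \<xi>
  proof -
    have D: "(x, \<xi>) \<in> phase_D_bar \<Omega>" using that Omega_S1_subset by blast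
    have "P_in \<Omega> x \<xi> \<in> A \<union> \<gamma> \<or> P_in \<Omega> x \<xi> \<in> B"
      using P_in_frontier[OF D] frontier_split by blast
    hence "\<bar>I0 (P_in \<Omega> x \<xi>, \<xi>)\<bar> \<le> \<bar>C\<bar>" using incoming_data[OF D] by auto
    hence "exp (- M_t \<mu>t x \<xi> R) * \<bar>I0 (P_in \<Omega> x \<xi>, \<xi>)\<bar> \<le> 1 * \<bar>C\<bar>"
      using M_t_nonneg by (intro mult_mono) auto
    thus ?thesis by (simp add: ballistic_def abs_mult)
  qed
  thus "\<exists>b. \<forall>z\<in>\<Omega> \<times> S1. \<bar>ballistic z\<bar> \<le> b" by (intro exI[of _ "\<bar>C\<bar>"]) blast
next
  fix y assume y: "y \<in> \<Omega>"
  \<comment> \<open>Backward from the interior point \<open>y\<close>, a cut point \<open>g\<close>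
    is hit only in the direction \<open>sgn (y - g)\<close>, so each cut point spoils a single
    direction.\<close>
  define N where "N = E \<union> (\<lambda>g. sgn (y - g)) ` \<gamma>"
  have "continuous (at (y, \<xi>) within \<Omega> \<times> S1) ballistic" if xi: "\<xi> \<in> S1 - N" for \<xi>
  proof -
    have D: "(y, \<xi>) \<in> phase_D_bar \<Omega>" using y xi Omega_S1_subset by blast
    hence reg: "(y, \<xi>) \<in> regular" using xi by (simp add: regular_def N_def)
    have "P_in \<Omega> y \<xi> \<notin> \<gamma>"
    proof
      assume g: "P_in \<Omega> y \<xi> \<in> \<gamma>"
      have "P_in \<Omega> y \<xi> \<notin> \<Omega>"
        using P_in_frontier[OF D] open_dom by (simp add: frontier_def interior_open)
      hence "tau_minus \<Omega> y \<xi> \<noteq> 0" using y by (auto simp: P_in_def)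
      hence "0 < tau_minus \<Omega> y \<xi>" using tau_minus_nonneg[OF D] by simp
      hence "sgn (y - P_in \<Omega> y \<xi>) = \<xi>"
        using phase_D_barD(3)[OF D] by (simp add: P_in_def sgn_scaleR sgn_div_norm[of \<xi>])
      with g xi show False by (force simp: N_def)
    qed
    from ballistic_continuous[OF reg this] Omega_S1_subset
    show ?thesis by (rule continuous_within_subset)
  qed
  moreover have "finite N" using finite_E finite_cut by (simp add: N_def)
  ultimately show "\<exists>N. finite N \<and> (\<forall>\<xi>\<in>S1 - N. continuous (at (y, \<xi>) within \<Omega> \<times> S1) ballistic)"
    by blast
qed

lemma continuous_on_stream_solution: "continuous_on regular (stream (scatter I))"
proof -
  have "bounded (I ` phase_D \<Omega>)" and I: "I \<in> borel_measurable (restrict_space borel (phase_D \<Omega>))"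
    using solution unfolding transport_solution_def by auto
  then obtain c where "\<forall>z\<in>phase_D \<Omega>. \<bar>I z\<bar> \<le> c" unfolding bounded_iff by auto
  moreover have sub: "\<Omega> \<times> S1 \<subseteq> phase_D \<Omega>" using interior_phase_D by auto
  ultimately have c: "\<forall>z\<in>\<Omega> \<times> S1. \<bar>I z\<bar> \<le> c" by blast
  have eq: "\<forall>z\<in>\<Omega> \<times> S1. I z = ballistic z + stream (scatter I) z"
    using solution_eq sub by fast
  note S = continuous_on_scatter_solution[OF almost_continuous_ballistic eq I c]
  show ?thesis by (rule continuous_on_stream[OF S]) simp
qed

lemma tau_minus_pos_Gamma_plus:
  assumes "(x, \<xi>) \<in> Gamma_plus \<Omega>"
  shows "0 < tau_minus \<Omega> x \<xi>"
proof -
  have D: "(x, \<xi>) \<in> phase_D_bar \<Omega>" using assms by (simp add: phase_D_bar_def)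
  obtain t where t: "t > 0" "x - t *\<^sub>R \<xi> \<in> \<Omega>" using assms by (auto simp: Gamma_plus_eq)
  hence "\<not> tau_minus \<Omega> x \<xi> < t" using after_tau_minus[OF D] closure_subset[of \<Omega>] by blast
  thus ?thesis using t by simp
qed

lemma P_in_along_ray:
  assumes D: "(x, \<xi>) \<in> phase_D_bar \<Omega>" and t: "0 < t" "t < tau_minus \<Omega> x \<xi>"
  shows "(x - t *\<^sub>R \<xi>, \<xi>) \<in> phase_D \<Omega>" "P_in \<Omega> (x - t *\<^sub>R \<xi>) \<xi> = P_in \<Omega> x \<xi>"
proof -
  show D': "(x - t *\<^sub>R \<xi>, \<xi>) \<in> phase_D \<Omega>"
    using before_tau_minus[OF D t] phase_D_barD(2)[OF D] by (rule interior_phase_D)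
  have "P_in \<Omega> x \<xi> + (tau_minus \<Omega> x \<xi> - t) *\<^sub>R \<xi> = x - t *\<^sub>R \<xi>"
    by (simp add: P_in_def scaleR_left_diff_distrib)
  thus "P_in \<Omega> (x - t *\<^sub>R \<xi>) \<xi> = P_in \<Omega> x \<xi>"
    using tau_minus_forward(2)[OF P_in_Gamma_minus[OF D], of "tau_minus \<Omega> x \<xi> - t"] t D' phase_D_subset
    by (simp add: subset_iff)
qed

text \<open>The limit defining the extension runs along the ray itself, where the entry point is
  constant. Hence the formula holds on the outflow boundary even if the entry point is a cut
  point.\<close>

lemma extended_solution_eq:
  assumes reg: "(x, \<xi>) \<in> regular"
  shows "extended_solution \<Omega> I (x, \<xi>) = ballistic (x, \<xi>) + stream (scatter I) (x, \<xi>)"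
proof (cases "(x, \<xi>) \<in> Gamma_plus \<Omega>")
  case False
  hence "(x, \<xi>) \<in> phase_D \<Omega>" using regularD(1)[OF reg] by (simp add: phase_D_bar_def)
  thus ?thesis using False solution_eq by (simp add: extended_solution_def)
next
  case True
  note D = regularD(1)[OF reg]
  have "\<forall>\<^sub>F t in at_right 0. t < tau_minus \<Omega> x \<xi>"
    using tau_minus_pos_Gamma_plus[OF True] by (rule order_tendstoD(2)[OF tendsto_ident_at])
  moreover have "\<forall>\<^sub>F t in at_right 0. 0 < (t :: real)" by (rule eventually_at_right_less)
  ultimately have ev: "\<forall>\<^sub>F t in at_right 0. 0 < t \<and> t < tau_minus \<Omega> x \<xi>" by eventually_elim simp
  have in_reg: "\<forall>\<^sub>F t in at_right 0. (x - t *\<^sub>R \<xi>, \<xi>) \<in> regular"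
    using ev
  proof eventually_elim
    case (elim t)
    thus ?case using P_in_along_ray(1)[OF D] phase_D_subset reg by (auto simp: regular_def)
  qed
  have "((\<lambda>t. (x - t *\<^sub>R \<xi>, \<xi>)) \<longlongrightarrow> (x - 0 *\<^sub>R \<xi>, \<xi>)) (at_right 0)"
    by (intro tendsto_intros)
  hence lim: "((\<lambda>t. (x - t *\<^sub>R \<xi>, \<xi>)) \<longlongrightarrow> (x, \<xi>)) (at_right 0)" by simp
  have "((\<lambda>t. M_t \<mu>t (x - t *\<^sub>R \<xi>) \<xi> R) \<longlongrightarrow> M_t \<mu>t x \<xi> R) (at_right 0)"
    using continuous_on_tendsto_compose[OF continuous_on_M_t lim reg in_reg] by simp
  hence "((\<lambda>t. exp (- M_t \<mu>t (x - t *\<^sub>R \<xi>) \<xi> R) * I0 (P_in \<Omega> x \<xi>, \<xi>) +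
      stream (scatter I) (x - t *\<^sub>R \<xi>, \<xi>)) \<longlongrightarrow> ballistic (x, \<xi>) + stream (scatter I) (x, \<xi>)) (at_right 0)"
    unfolding ballistic_def prod.case
    by (intro tendsto_add tendsto_mult tendsto_const tendsto_exp tendsto_minus
        continuous_on_tendsto_compose[OF continuous_on_stream_solution lim reg in_reg])
  moreover have "\<forall>\<^sub>F t in at_right 0. exp (- M_t \<mu>t (x - t *\<^sub>R \<xi>) \<xi> R) * I0 (P_in \<Omega> x \<xi>, \<xi>) +
      stream (scatter I) (x - t *\<^sub>R \<xi>, \<xi>) = I (x - t *\<^sub>R \<xi>, \<xi>)"
    using ev
  proof eventually_elim
    case (elim t)
    thus ?case
      using solution_eq[OF P_in_along_ray(1)[OF D]] P_in_along_ray(2)[OF D] by (simp add: ballistic_def)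
  qed
  ultimately have "((\<lambda>t. I (x - t *\<^sub>R \<xi>, \<xi>)) \<longlongrightarrow>
      ballistic (x, \<xi>) + stream (scatter I) (x, \<xi>)) (at_right 0)"
    by (rule Lim_transform_eventually)
  from tendsto_Lim[OF _ this] show ?thesis using True by (simp add: extended_solution_def)
qed

text \<open>Away from the cut points both summands of the representation are continuous, and the
  representation holds at every regular point, outflow boundary included.\<close>

lemma disc_imp_P_in_cut:
  assumes disc: "(x, \<xi>) \<in> disc_on (phase_D_bar \<Omega>) (extended_solution \<Omega> I)" and xi: "\<xi> \<notin> E"
  shows "(x, \<xi>) \<in> regular" "P_in \<Omega> x \<xi> \<in> \<gamma>"
proof -
  show reg: "(x, \<xi>) \<in> regular" using disc xi by (simp add: disc_on_def regular_def)
  show "P_in \<Omega> x \<xi> \<in> \<gamma>"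
  proof (rule ccontr)
    let ?J = "\<lambda>z. ballistic z + stream (scatter I) z"
    assume "P_in \<Omega> x \<xi> \<notin> \<gamma>"
    hence "continuous (at (x, \<xi>) within regular) ballistic"
      using ballistic_continuous[OF reg] unfolding at_regular[OF reg] by blast
    moreover have "continuous (at (x, \<xi>) within regular) (stream (scatter I))"
      using continuous_on_stream_solution reg by (simp add: continuous_on_eq_continuous_within)
    ultimately have "continuous (at (x, \<xi>) within regular) ?J" by (rule continuous_add)
    hence "(?J \<longlongrightarrow> ?J (x, \<xi>)) (at (x, \<xi>) within regular)" by (simp only: continuous_within)
    moreover have "\<forall>\<^sub>F z in at (x, \<xi>) within regular. ?J z = extended_solution \<Omega> I z"
      unfolding eventually_at_filter using extended_solution_eq by (intro always_eventually) auto
    ultimately have "(extended_solution \<Omega> I \<longlongrightarrow> ?J (x, \<xi>)) (at (x, \<xi>) within regular)"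
      by (rule Lim_transform_eventually)
    hence "continuous (at (x, \<xi>) within phase_D_bar \<Omega>) (extended_solution \<Omega> I)"
      unfolding at_regular[OF reg] continuous_within extended_solution_eq[OF reg] .
    with disc show False by (simp add: disc_on_def)
  qed
qed

text \<open>Since the direction does not vary, the approach stays in \<open>regular\<close>. The
  side enters through \<open>c\<close> alone, so the \<open>stream\<close> part cancels in the
  jump.\<close>

lemma one_sided_limit:
  assumes reg: "(x, \<xi>) \<in> regular"
    and c: "\<And>y. (y, \<xi>) \<in> phase_D_bar \<Omega> \<Longrightarrow> P_in \<Omega> y \<xi> \<in> T \<Longrightarrow> I0 (P_in \<Omega> y \<xi>, \<xi>) = c"
  shows "((\<lambda>y. I (y, \<xi>)) \<longlongrightarrow> exp (- M_t \<mu>t x \<xi> R) * c + stream (scatter I) (x, \<xi>))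
    (approach \<Omega> T x \<xi>)"
proof -
  let ?F = "approach \<Omega> T x \<xi>"
  have ev: "\<forall>\<^sub>F y in ?F. (y, \<xi>) \<in> phase_D \<Omega> \<and> P_in \<Omega> y \<xi> \<in> T"
    unfolding approach_def eventually_at_filter by simp
  have in_reg: "\<forall>\<^sub>F y in ?F. (y, \<xi>) \<in> regular"
    using ev
  proof eventually_elim
    case (elim y)
    thus ?case using phase_D_subset reg by (auto simp: regular_def)
  qed
  have lim: "((\<lambda>y. (y, \<xi>)) \<longlongrightarrow> (x, \<xi>)) ?F"
    unfolding approach_def by (intro tendsto_intros)
  have "((\<lambda>y. M_t \<mu>t y \<xi> R) \<longlongrightarrow> M_t \<mu>t x \<xi> R) ?F"
    using continuous_on_tendsto_compose[OF continuous_on_M_t lim reg in_reg] by simp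
  hence "((\<lambda>y. exp (- M_t \<mu>t y \<xi> R) * c + stream (scatter I) (y, \<xi>)) \<longlongrightarrow>
      exp (- M_t \<mu>t x \<xi> R) * c + stream (scatter I) (x, \<xi>)) ?F"
    by (intro tendsto_add tendsto_mult tendsto_const tendsto_exp tendsto_minus
        continuous_on_tendsto_compose[OF continuous_on_stream_solution lim reg in_reg])
  moreover have "\<forall>\<^sub>F y in ?F. exp (- M_t \<mu>t y \<xi> R) * c + stream (scatter I) (y, \<xi>) = I (y, \<xi>)"
    using ev
  proof eventually_elim
    case (elim y)
    hence "I0 (P_in \<Omega> y \<xi>, \<xi>) = c" using c phase_D_subset by blast
    thus ?case using solution_eq elim by (simp add: ballistic_def)
  qed
  ultimately show ?thesis by (rule Lim_transform_eventually)
qed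

lemma jump_at_discontinuity:
  assumes disc: "(x, \<xi>) \<in> disc_on (phase_D_bar \<Omega>) (extended_solution \<Omega> I)" and xi: "\<xi> \<notin> E"
  shows "has_jump \<Omega> (A \<union> \<gamma>) B I x \<xi> (C * exp (- M_t \<mu>t x \<xi> (tau_minus \<Omega> x \<xi>)))"
proof -
  note reg = disc_imp_P_in_cut(1)[OF disc xi] and P = disc_imp_P_in_cut(2)[OF disc xi]
  note D = regularD(1)[OF reg]
  show ?thesis unfolding has_jump_def
  proof (intro conjI exI)
    show "approach \<Omega> (A \<union> \<gamma>) x \<xi> \<noteq> bot" by (rule approach_nontrivial[OF D P, of A]) auto
    show "approach \<Omega> B x \<xi> \<noteq> bot" by (rule approach_nontrivial[OF D P, of B]) auto
    show "((\<lambda>y. I (y, \<xi>)) \<longlongrightarrow> exp (- M_t \<mu>t x \<xi> R) * C + stream (scatter I) (x, \<xi>))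
        (approach \<Omega> (A \<union> \<gamma>) x \<xi>)"
      by (rule one_sided_limit[OF reg]) (rule incoming_data(1))
    show "((\<lambda>y. I (y, \<xi>)) \<longlongrightarrow> exp (- M_t \<mu>t x \<xi> R) * 0 + stream (scatter I) (x, \<xi>))
        (approach \<Omega> B x \<xi>)"
      by (rule one_sided_limit[OF reg]) (rule incoming_data(2))
    show "C * exp (- M_t \<mu>t x \<xi> (tau_minus \<Omega> x \<xi>)) =
        exp (- M_t \<mu>t x \<xi> R) * C + stream (scatter I) (x, \<xi>) -
        (exp (- M_t \<mu>t x \<xi> R) * 0 + stream (scatter I) (x, \<xi>))"
      by (simp add: M_t_tau_minus[OF D])
  qed
qed

end

section \<open>Straight interfaces and the proof of the theorem\<close>

lemma open_segment_difference:
  fixes a b :: "'a::real_vector"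
  assumes "x \<in> open_segment a b" "y \<in> open_segment a b"
  shows "\<exists>c. y - x = c *\<^sub>R (b - a)"
proof -
  obtain u v where xy: "x = (1 - u) *\<^sub>R a + u *\<^sub>R b" "y = (1 - v) *\<^sub>R a + v *\<^sub>R b"
    using assms by (auto simp: in_segment)
  have "y - x = (v - u) *\<^sub>R (b - a)" unfolding xy by (simp add: algebra_simps)
  thus ?thesis by blast
qed

text \<open>Two hits would make the unit vector \<open>\<xi>\<close> parallel to the segment, as the
  unit vector \<open>d\<close> is, hence equal to \<open>d\<close> or \<open>- d\<close>. So there
  is at most one hit.\<close>

lemma line_meets_transversal_segment:
  fixes \<xi> d :: "'a::real_normed_vector"
  assumes S: "S = open_segment a b" "S \<noteq> {}" and d: "norm d = 1" "\<forall>y\<in>S. \<exists>t>0. y + t *\<^sub>R d \<in> S"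
    and xi: "norm \<xi> = 1" "\<xi> \<noteq> d" "\<xi> \<noteq> - d"
  shows "finite {t. x - t *\<^sub>R \<xi> \<in> S}"
proof -
  obtain y t where y: "y \<in> S" "t > 0" "y + t *\<^sub>R d \<in> S" using S(2) d(2) by blast
  obtain c where "t *\<^sub>R d = c *\<^sub>R (b - a)"
    using open_segment_difference[of y a b "y + t *\<^sub>R d"] y S(1) by auto
  hence "(1 / t) *\<^sub>R (t *\<^sub>R d) = (1 / t) *\<^sub>R (c *\<^sub>R (b - a))" by (simp only:)
  hence dc: "d = (c / t) *\<^sub>R (b - a)" using y(2) by simp
  have "s = s'" if s: "x - s *\<^sub>R \<xi> \<in> S" "x - s' *\<^sub>R \<xi> \<in> S" for s s'
  proof (rule ccontr)
    assume ne: "s \<noteq> s'"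
    obtain e where "(s - s') *\<^sub>R \<xi> = e *\<^sub>R (b - a)"
      using open_segment_difference[OF s[unfolded S(1)]] by (auto simp: scaleR_left_diff_distrib)
    hence "(1 / (s - s')) *\<^sub>R ((s - s') *\<^sub>R \<xi>) = (1 / (s - s')) *\<^sub>R (e *\<^sub>R (b - a))" by (simp only:)
    hence xe: "\<xi> = (e / (s - s')) *\<^sub>R (b - a)" using ne by simp
    have "\<bar>c / t\<bar> * norm (b - a) = 1" using d(1) unfolding dc norm_scaleR .
    moreover have "\<bar>e / (s - s')\<bar> * norm (b - a) = 1" using xi(1) unfolding xe norm_scaleR .
    ultimately have "\<bar>e / (s - s')\<bar> = \<bar>c / t\<bar>" by (metis mult_cancel_right mult_zero_right zero_neq_one)
    hence "e / (s - s') = c / t \<or> e / (s - s') = - (c / t)" by (simp only: abs_eq_iff)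
    thus False using xi(2,3) dc xe by (metis scaleR_minus_left)
  qed
  hence "\<exists>s. {t. x - t *\<^sub>R \<xi> \<in> S} \<subseteq> {s}" by blast
  thus ?thesis using finite_subset by blast
qed

theorem theorem3p3:
  fixes \<Omega> \<Omega>0 A B \<gamma> :: "(real^2) set"
    and \<Omega>' L :: "nat \<Rightarrow> (real^2) set"
    and N K :: nat
    and \<xi>p :: "nat \<Rightarrow> real^2"
    and \<mu>t \<mu>s :: "real^2 \<Rightarrow> real"
    and p :: "real^2 \<Rightarrow> real^2 \<Rightarrow> real^2 \<Rightarrow> real"
    and C :: real
    and I0 I :: "(real^2) \<times> (real^2) \<Rightarrow> real"
    and xs \<xi>s :: "real^2"
  assumes domain: "open \<Omega>" "\<Omega> \<noteq> {}" "convex \<Omega>" "bounded \<Omega>" "C1_boundary \<Omega>"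
    and subdomains:
      "\<forall>j\<in>{1..N}. open (\<Omega>' j) \<and> connected (\<Omega>' j) \<and> \<Omega>' j \<noteq> {} \<and> \<Omega>' j \<subseteq> \<Omega> \<and>
         piecewise_C1_boundary (\<Omega>' j)"
      "disjoint_family_on \<Omega>' {1..N}"
      "closure \<Omega> = (\<Union>j\<in>{1..N}. closure (\<Omega>' j))"
    and Omega0: "\<Omega>0 = (\<Union>j\<in>{1..N}. \<Omega>' j)"
    and segments:
      "K \<ge> 1"
      "bij_betw L {1..K} (maximal_segments (frontier \<Omega>0 - frontier \<Omega>))"
    and no_other_straight_part:
      "null_on_lines ((frontier \<Omega>0 - frontier \<Omega>) - (\<Union>j\<in>{1..K}. L j))"
    and directions:
      "\<forall>j\<in>{1..K}. \<xi>p j \<in> S1 \<and> (\<forall>x\<in>L j. \<exists>t>0. x + t *\<^sub>R \<xi>p j \<in> L j)"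
    and mu:
      "\<forall>x. 0 \<le> \<mu>s x \<and> \<mu>s x \<le> \<mu>t x"
      "bounded (range \<mu>t)" "bounded (range \<mu>s)"
      "continuous_on \<Omega>0 \<mu>t" "continuous_on \<Omega>0 \<mu>s"
      "\<forall>x. x \<notin> \<Omega>0 \<longrightarrow> \<mu>t x = 0 \<and> \<mu>s x = 0"
    and p:
      "\<forall>x. \<forall>\<xi>\<in>S1. \<forall>\<xi>'\<in>S1. 0 \<le> p x \<xi> \<xi>'"
      "\<exists>b. \<forall>x. \<forall>\<xi>\<in>S1. \<forall>\<xi>'\<in>S1. p x \<xi> \<xi>' \<le> b"
      "continuous_on (\<Omega>0 \<times> S1 \<times> S1) (\<lambda>(x, \<xi>, \<xi>'). p x \<xi> \<xi>')"
      "\<forall>x. \<forall>\<xi>\<in>S1. \<forall>\<xi>'\<in>S1. x \<notin> \<Omega>0 \<longrightarrow> p x \<xi> \<xi>' = 0"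
      "\<forall>x\<in>\<Omega>0. \<forall>\<xi>\<in>S1. (LINT \<xi>'|circle_measure. p x \<xi> \<xi>') = 1"
    and gamma: "\<gamma> \<subseteq> frontier \<Omega>" "card \<gamma> = 2"
    and AB: "components (frontier \<Omega> - \<gamma>) = {A, B}" "A \<noteq> B"
    and C: "C \<noteq> 0"
    and boundary_data:
      "\<forall>(x, \<xi>)\<in>Gamma_minus \<Omega>. x \<in> A \<union> \<gamma> \<longrightarrow> I0 (x, \<xi>) = C"
      "\<forall>(x, \<xi>)\<in>Gamma_minus \<Omega>. x \<in> B \<longrightarrow> I0 (x, \<xi>) = 0"
    and solution: "transport_solution \<Omega> \<mu>t \<mu>s p I0 I"
    and discontinuity: "(xs, \<xi>s) \<in> disc_on (phase_D_bar \<Omega>) (extended_solution \<Omega> I)"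
    and not_along_segments: "\<forall>j\<in>{1..K}. \<xi>s \<noteq> \<xi>p j \<and> \<xi>s \<noteq> - \<xi>p j"
  shows "has_jump \<Omega> (A \<union> \<gamma>) B I xs \<xi>s
           (C * exp (- (LINT r:{0..tau_minus \<Omega> xs \<xi>s}|lborel. \<mu>t (xs - r *\<^sub>R \<xi>s))))"
proof -
  interpret C1_convex_domain \<Omega> using domain by unfold_locales
  have Omega0': "open \<Omega>0" "\<Omega>0 \<subseteq> \<Omega>" using subdomains(1) Omega0 by auto
  define E where "E = \<xi>p ` {1..K} \<union> (\<lambda>j. - \<xi>p j) ` {1..K}"
  let ?F = "frontier \<Omega>0 - frontier \<Omega>"
  \<comment> \<open>The closures of the subdomains cover \<Omega>, so a point of \<Omega> outside
    \<open>\<Omega>0\<close> is a limit of points of \<open>\<Omega>0\<close>.\<close>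
  have interface: "\<Omega> - \<Omega>0 \<subseteq> ?F"
  proof
    fix x assume x: "x \<in> \<Omega> - \<Omega>0"
    hence "x \<in> (\<Union>j\<in>{1..N}. closure (\<Omega>' j))" using subdomains(3) closure_subset[of \<Omega>] by blast
    moreover have "closure (\<Omega>' j) \<subseteq> closure \<Omega>0" if "j \<in> {1..N}" for j
      using that Omega0 by (intro closure_mono) blast
    ultimately have "x \<in> closure \<Omega>0" by blast
    thus "x \<in> ?F" using x Omega0' open_dom by (simp add: frontier_def interior_open)
  qed
  \<comment> \<open>The interface consists of the segments, each met at most once in a direction
    outside \<open>E\<close>, and of a rest that is null on every line by
    \<open>no_other_straight_part\<close>.\<close>
  have null: "{t. x - t *\<^sub>R \<xi> \<in> \<Omega> - \<Omega>0} \<in> null_sets lborel" if xi: "\<xi> \<in> S1 - E" for x \<xi>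
  proof -
    let ?L = "\<Union>j\<in>{1..K}. {t. x - t *\<^sub>R \<xi> \<in> L j}"
    \<comment> \<open>\<open>null_on_lines\<close> parametrises lines forward and rays run backward,
      so it is applied to the opposite direction.\<close>
    have "- \<xi> \<in> S1" using xi by simp
    hence "{t. x + t *\<^sub>R (- \<xi>) \<in> ?F - (\<Union>j\<in>{1..K}. L j)} \<in> null_sets lborel"
      using no_other_straight_part unfolding null_on_lines_def by blast
    moreover have "finite ?L"
    proof (intro finite_UN_I finite_atLeastAtMost)
      fix j assume j: "j \<in> {1..K}"
      hence "L j \<in> maximal_segments ?F" using segments(2) bij_betwE by blast
      then obtain a b where ab: "a \<noteq> b" "L j = open_segment a b" by (auto simp: maximal_segments_def)
      have "L j \<noteq> {}" using ab by simp
      moreover have "\<xi> \<noteq> \<xi>p j" "\<xi> \<noteq> - \<xi>p j" using xi j by (auto simp: E_def)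
      ultimately show "finite {t. x - t *\<^sub>R \<xi> \<in> L j}"
        using ab(2) bspec[OF directions j] xi
        by (intro line_meets_transversal_segment[of "L j" a b "\<xi>p j"]) (simp_all del: open_segment_eq_empty)
    qed
    hence "?L \<in> null_sets lborel" by (rule finite_imp_null_set_lborel)
    ultimately have "{t. x + t *\<^sub>R (- \<xi>) \<in> ?F - (\<Union>j\<in>{1..K}. L j)} \<union> ?L \<in> null_sets lborel"
      by (rule null_sets.Un)
    \<comment> \<open>\<open>lborel\<close> is not complete, so a subset of a null set must be shown
      measurable separately.\<close>
    moreover have "{t. x - t *\<^sub>R \<xi> \<in> \<Omega> - \<Omega>0} \<in> sets lborel"
    proof -
      have "\<Omega> - \<Omega>0 \<in> sets borel" using open_dom Omega0'(1) by (intro sets.Diff borel_open)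
      moreover have "(\<lambda>t. x - t *\<^sub>R \<xi>) \<in> borel_measurable borel" by measurable
      ultimately have "(\<lambda>t. x - t *\<^sub>R \<xi>) -` (\<Omega> - \<Omega>0) \<inter> space borel \<in> sets borel"
        by (rule measurable_sets[rotated])
      thus ?thesis by (simp add: vimage_def)
    qed
    moreover have "{t. x - t *\<^sub>R \<xi> \<in> \<Omega> - \<Omega>0} \<subseteq>
        {t. x + t *\<^sub>R (- \<xi>) \<in> ?F - (\<Union>j\<in>{1..K}. L j)} \<union> ?L"
      using interface by auto
    ultimately show ?thesis by (rule null_sets_subset)
  qed
  obtain m where m: "\<And>x. norm (\<mu>t x) \<le> m" using mu(2) by (auto simp: bounded_iff)
  obtain pb where pb: "\<forall>x. \<forall>\<xi>\<in>S1. \<forall>\<xi>'\<in>S1. p x \<xi> \<xi>' \<le> pb" using p(2) by blast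
  obtain R where R: "R > 0" "\<forall>x\<in>closure \<Omega>. \<forall>\<xi>\<in>S1. \<forall>t>R. x - t *\<^sub>R \<xi> \<notin> \<Omega>"
    using exists_radius by blast
  have "transport_problem \<Omega> \<Omega>0 E \<mu>t \<mu>s p m pb R \<gamma> A B C I0 I"
  proof
    show "finite E" by (simp add: E_def)
    show "\<mu>t x \<le> m" for x using m[of x] by simp
    show "0 \<le> R" using R(1) by simp
    show "x - t *\<^sub>R \<xi> \<notin> \<Omega>" if "x \<in> closure \<Omega>" "\<xi> \<in> S1" "R < t" for x \<xi> t
      using R(2) that by blast
    show "0 \<le> \<mu>s x" "\<mu>s x \<le> \<mu>t x" for x using mu(1) by auto
    show "x \<notin> \<Omega>0 \<Longrightarrow> \<mu>t x = 0" "x \<notin> \<Omega>0 \<Longrightarrow> \<mu>s x = 0" for x using mu(6) by auto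
    show "0 \<le> p x \<xi> \<xi>'" "p x \<xi> \<xi>' \<le> pb" if "\<xi> \<in> S1" "\<xi>' \<in> S1" for x \<xi> \<xi>'
      using p(1) pb that by blast+
    show "(LINT \<xi>'|circle_measure. p x \<xi> \<xi>') = 1" if "x \<in> \<Omega>0" "\<xi> \<in> S1" for x \<xi>
      using p(5) that by blast
  qed (fact Omega0' null mu(4,5) p(3) gamma AB boundary_data solution)+
  moreover have "\<xi>s \<notin> E" using not_along_segments by (auto simp: E_def)
  ultimately show ?thesis
    using transport_problem.jump_at_discontinuity[OF _ discontinuity] by (simp add: M_t_def)
qed

end
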